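(* Let $(X,r)$ be a soluble solution of the Yang-Baxter equation. Then its structure skew brace $G_X=G(X,r)$ is a soluble skew brace.
   Context: **Solutions.** A solution (of the Yang-Baxter equation) is a pair $(X,r)$ with $X$ a nonempty set and $r\colon X\times X\to X\times X$ a map satisfying $(r\times\mathrm{id})(\mathrm{id}\times r)(r\times\mathrm{id})=(\mathrm{id}\times r)(r\times\mathrm{id})(\mathrm{id}\times r)$. Write $r(x,y)=(\lambda_x(y),\rho_y(x))$. All solutions are assumed non-degenerate: $\lambda_x$ and $\rho_x$ are bijective for every $x\in X$ (it is known that $r$ is then bijective). **Skew braces.** A skew brace is $(B,+,\cdot)$ where $(B,+)$ and $(B,\cdot)$ are (not necessarily abelian) groups and $a(b+c)=ab-a+ac$ for all $a,b,c$; both groups have the same identity, denoted $0$. Put $\lambda_a(b)=-a+ab$ and $\rho_b(a)=\lambda_a(b)^{-1}ab$. The solution associated with $B$ is $(B,r_B)$, $r_B(a,b)=(\lambda_a(b),\rho_b(a))$. An ideal of $B$ is a subset that is a normal subgroup of both $(B,+)$ and $(B,\cdot)$ and is invariant under all $\lambda_a$, $a \in B$. A skew brace is abelian if $a+b=ab$ for all $a,b$ and the group is abelian; an abelian ideal is an ideal that is an abelian skew brace. $B$ is soluble if it has a finite chain of ideals $0=I_t\subseteq\dots\subseteq I_1\subseteq I_0=B$ of $B$ with each $I_{k-1}/I_k$ an abelian skew brace. **Structure skew brace.** For a solution $(X,r)$, $(G_X,\cdot)=\langle X\mid xy=\lambda_x(y)\rho_y(x),\ x,y\in X\rangle$, with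 canonical map $\iota\colon X\to G_X$ (not necessarily injective). There is a unique addition making $(G_X,+,\cdot)$ a skew brace such that $r_{G_X}(\iota\times\iota)=(\iota\times\iota)r$; this is the structure skew brace of $(X,r)$. **Homomorphisms and i-homomorphisms.** A homomorphism of solutions $(X,r)\to(Y,s)$ is a map $f\colon X\to Y$ with $(f\times f)r=s(f\times f)$; it is an epimorphism if surjective. $\ker f$ denotes the equivalence relation on $X$ given by $x(\ker f)y\iff f(x)=f(y)$, and $\ker\iota$ is defined likewise. A homomorphism $f$ is an i-homomorphism if there is an equivalence class $X_0\subseteq X$ of $\ker f$ such that $r(X_0\times Z)=Z\times X_0$ and $r(Z\times X_0)=X_0\times Z$ for every equivalence class $Z$ of $\ker f$; such an $X_0$ is called an i-kernel of $f$. An i-epimorphism is a surjective i-homomorphism. **Soluble solutions.** A solution $(X,r)$ is soluble if there exist an integer $t\ge 1$, skew braces $B_0,\dots,B_t$, i-epimorphisms of solutions $f_k\colon (X,r)\to (B_k,r_{B_k})$ with respective i-kernels $X_k\subseteq X$ for $0\le k\le t-1$, and an epimorphism of solutions $f_t\colon (X,r)\to (B_t,r_{B_t})$, such that for every $1\le k\le t$: (1) $\ker f_k\subseteq\ker f_{k-1}$; moreover $\ker f_0$ has $X$ as its only equivalence class, and $\ker f_t\subseteq\ker\iota$; (2) $f_k(X_{k-1})$ is contained in an abelian ideal $J$ of $B_k$ such that $f_k(x)J=f_k(y)J$ for all $x,y\in X$ with $x(\ker f_{k-1})y$. *)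

theory Defs
  imports "HOL-Algebra.AbelCoset"
begin

section \<open>Skew braces\<close>

text \<open>
  Skew braces use the record type of rings from HOL-Algebra, whose additive part is not
  required to be commutative here. The two units coincide by the distributivity axiom
  (put \<open>b = c = \<zero>\<close>), so this is not assumed separately.
\<close>

locale skew_brace =
  fixes B :: "'b ring" (structure)
  assumes add_group: "group (add_monoid B)"
    and mult_group: "group B"
    and skew_distrib: "\<lbrakk>a \<in> carrier B; b \<in> carrier B; c \<in> carrier B\<rbrakk>
      \<Longrightarrow> a \<otimes> (b \<oplus> c) = ((a \<otimes> b) \<oplus> (\<ominus> a)) \<oplus> (a \<otimes> c)"

definition brace_lambda :: "'b ring \<Rightarrow> 'b \<Rightarrow> 'b \<Rightarrow> 'b" where
  "brace_lambda B a b = (\<ominus>\<^bsub>B\<^esub> a) \<oplus>\<^bsub>B\<^esub> (a \<otimes>\<^bsub>B\<^esub> b)"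

definition brace_rho :: "'b ring \<Rightarrow> 'b \<Rightarrow> 'b \<Rightarrow> 'b" where
  "brace_rho B b a = (inv\<^bsub>B\<^esub> (brace_lambda B a b) \<otimes>\<^bsub>B\<^esub> a) \<otimes>\<^bsub>B\<^esub> b"

definition brace_solution :: "'b ring \<Rightarrow> 'b \<times> 'b \<Rightarrow> 'b \<times> 'b" where
  "brace_solution B = (\<lambda>(a, b). (brace_lambda B a b, brace_rho B b a))"

definition brace_ideal :: "'b set \<Rightarrow> 'b ring \<Rightarrow> bool" where
  "brace_ideal I B \<longleftrightarrow> I \<lhd> add_monoid B \<and> I \<lhd> B \<and>
     (\<forall>a\<in>carrier B. brace_lambda B a ` I \<subseteq> I)"

definition abelian_skew_brace :: "'b ring \<Rightarrow> bool" where
  "abelian_skew_brace B \<longleftrightarrow> skew_brace B \<and> comm_group B \<and>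
     (\<forall>a\<in>carrier B. \<forall>b\<in>carrier B. a \<oplus>\<^bsub>B\<^esub> b = a \<otimes>\<^bsub>B\<^esub> b)"

definition abelian_brace_ideal :: "'b set \<Rightarrow> 'b ring \<Rightarrow> bool" where
  "abelian_brace_ideal I B \<longleftrightarrow> brace_ideal I B \<and> abelian_skew_brace (B\<lparr>carrier := I\<rparr>)"

text \<open>
  For an ideal the additive and the multiplicative cosets, left or right, are the same sets;
  both operations of the quotient are the elementwise operations on cosets.
\<close>

definition brace_quotient :: "'b ring \<Rightarrow> 'b set \<Rightarrow> 'b set ring" where
  "brace_quotient B I =
     \<lparr>carrier = rcosets\<^bsub>B\<^esub> I, mult = set_mult B, one = I, zero = I, add = set_add B\<rparr>"

definition soluble_skew_brace :: "'b ring \<Rightarrow> bool" where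
  "soluble_skew_brace B \<longleftrightarrow> skew_brace B \<and>
     (\<exists>(t::nat) I. (\<forall>k\<le>t. brace_ideal (I k) B) \<and> I 0 = carrier B \<and> I t = {\<zero>\<^bsub>B\<^esub>} \<and>
       (\<forall>k\<in>{1..t}. I k \<subseteq> I (k - 1) \<and>
          abelian_skew_brace (brace_quotient (B\<lparr>carrier := I (k - 1)\<rparr>) (I k))))"

section \<open>Solutions of the Yang--Baxter equation\<close>

definition yb_left :: "('a \<times> 'a \<Rightarrow> 'a \<times> 'a) \<Rightarrow> 'a \<times> 'a \<times> 'a \<Rightarrow> 'a \<times> 'a \<times> 'a" where
  "yb_left r = (\<lambda>(x, y, z). (fst (r (x, y)), snd (r (x, y)), z))"

definition yb_right :: "('a \<times> 'a \<Rightarrow> 'a \<times> 'a) \<Rightarrow> 'a \<times> 'a \<times> 'a \<Rightarrow> 'a \<times> 'a \<times> 'a" where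
  "yb_right r = (\<lambda>(x, y, z). (x, r (y, z)))"

text \<open>
  With \<open>r (x, y) = (\<lambda>\<^sub>x y, \<rho>\<^sub>y x)\<close>, the last two conditions say that every \<open>\<lambda>\<^sub>x\<close> and every
  \<open>\<rho>\<^sub>x\<close> is bijective on \<open>X\<close>.
\<close>

definition yb_solution :: "'a set \<Rightarrow> ('a \<times> 'a \<Rightarrow> 'a \<times> 'a) \<Rightarrow> bool" where
  "yb_solution X r \<longleftrightarrow> X \<noteq> {} \<and> r \<in> X \<times> X \<rightarrow> X \<times> X \<and>
     (\<forall>p \<in> X \<times> X \<times> X. yb_left r (yb_right r (yb_left r p)) = yb_right r (yb_left r (yb_right r p))) \<and>
     (\<forall>x\<in>X. bij_betw (\<lambda>y. fst (r (x, y))) X X) \<and>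
     (\<forall>x\<in>X. bij_betw (\<lambda>y. snd (r (y, x))) X X)"

definition sol_hom ::
  "'a set \<Rightarrow> ('a \<times> 'a \<Rightarrow> 'a \<times> 'a) \<Rightarrow> 'b set \<Rightarrow> ('b \<times> 'b \<Rightarrow> 'b \<times> 'b) \<Rightarrow> ('a \<Rightarrow> 'b) \<Rightarrow> bool" where
  "sol_hom X r Y s f \<longleftrightarrow> f \<in> X \<rightarrow> Y \<and>
     (\<forall>x\<in>X. \<forall>y\<in>X. map_prod f f (r (x, y)) = s (f x, f y))"

definition sol_epi ::
  "'a set \<Rightarrow> ('a \<times> 'a \<Rightarrow> 'a \<times> 'a) \<Rightarrow> 'b set \<Rightarrow> ('b \<times> 'b \<Rightarrow> 'b \<times> 'b) \<Rightarrow> ('a \<Rightarrow> 'b) \<Rightarrow> bool" where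
  "sol_epi X r Y s f \<longleftrightarrow> sol_hom X r Y s f \<and> f ` X = Y"

definition ker_rel :: "'a set \<Rightarrow> ('a \<Rightarrow> 'b) \<Rightarrow> ('a \<times> 'a) set" where
  "ker_rel X f = {(x, y). x \<in> X \<and> y \<in> X \<and> f x = f y}"

definition i_kernel :: "'a set \<Rightarrow> ('a \<times> 'a \<Rightarrow> 'a \<times> 'a) \<Rightarrow> ('a \<Rightarrow> 'b) \<Rightarrow> 'a set \<Rightarrow> bool" where
  "i_kernel X r f X0 \<longleftrightarrow> X0 \<in> X // ker_rel X f \<and>
     (\<forall>Z \<in> X // ker_rel X f. r ` (X0 \<times> Z) = Z \<times> X0 \<and> r ` (Z \<times> X0) = X0 \<times> Z)"

section \<open>Groups given by generators and relations\<close>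

text \<open>The letter \<open>(x, True)\<close> stands for \<open>x\<close> and \<open>(x, False)\<close> for its formal inverse.\<close>

type_synonym 'a word = "('a \<times> bool) list"

definition words :: "'a set \<Rightarrow> 'a word set" where
  "words X = lists (X \<times> UNIV)"

inductive_set word_eq :: "'a set \<Rightarrow> ('a word \<times> 'a word) set \<Rightarrow> ('a word \<times> 'a word) set"
  for X :: "'a set" and R :: "('a word \<times> 'a word) set" where
  rel: "\<lbrakk>(u, v) \<in> R; u \<in> words X; v \<in> words X\<rbrakk> \<Longrightarrow> (u, v) \<in> word_eq X R"
| cancel: "x \<in> X \<Longrightarrow> ([(x, b), (x, \<not> b)], []) \<in> word_eq X R"
| refl: "u \<in> words X \<Longrightarrow> (u, u) \<in> word_eq X R"
| sym: "(u, v) \<in> word_eq X R \<Longrightarrow> (v, u) \<in> word_eq X R"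
| trans: "\<lbrakk>(u, v) \<in> word_eq X R; (v, w) \<in> word_eq X R\<rbrakk> \<Longrightarrow> (u, w) \<in> word_eq X R"
| append: "\<lbrakk>(u, v) \<in> word_eq X R; (u', v') \<in> word_eq X R\<rbrakk> \<Longrightarrow> (u @ u', v @ v') \<in> word_eq X R"

definition presented_group :: "'a set \<Rightarrow> ('a word \<times> 'a word) set \<Rightarrow> 'a word set monoid" where
  "presented_group X R =
     \<lparr>carrier = words X // word_eq X R,
      mult = (\<lambda>A B. \<Union>u\<in>A. \<Union>v\<in>B. word_eq X R `` {u @ v}),
      one = word_eq X R `` {[]}\<rparr>"

section \<open>The structure skew brace of a solution\<close>

definition structure_relations :: "'a set \<Rightarrow> ('a \<times> 'a \<Rightarrow> 'a \<times> 'a) \<Rightarrow> ('a word \<times> 'a word) set" where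
  "structure_relations X r =
     {([(x, True), (y, True)], [(fst (r (x, y)), True), (snd (r (x, y)), True)]) | x y.
        x \<in> X \<and> y \<in> X}"

definition structure_group :: "'a set \<Rightarrow> ('a \<times> 'a \<Rightarrow> 'a \<times> 'a) \<Rightarrow> 'a word set monoid" where
  "structure_group X r = presented_group X (structure_relations X r)"

definition structure_map :: "'a set \<Rightarrow> ('a \<times> 'a \<Rightarrow> 'a \<times> 'a) \<Rightarrow> 'a \<Rightarrow> 'a word set" where
  "structure_map X r x = word_eq X (structure_relations X r) `` {[(x, True)]}"

definition structure_group_with_add ::
  "'a set \<Rightarrow> ('a \<times> 'a \<Rightarrow> 'a \<times> 'a) \<Rightarrow> ('a word set \<Rightarrow> 'a word set \<Rightarrow> 'a word set) \<Rightarrow> 'a word set ring"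
  where
  "structure_group_with_add X r pl =
     \<lparr>carrier = carrier (structure_group X r), mult = mult (structure_group X r),
      one = one (structure_group X r), zero = one (structure_group X r), add = pl\<rparr>"

definition structure_addition ::
  "'a set \<Rightarrow> ('a \<times> 'a \<Rightarrow> 'a \<times> 'a) \<Rightarrow> ('a word set \<Rightarrow> 'a word set \<Rightarrow> 'a word set) \<Rightarrow> bool" where
  "structure_addition X r pl \<longleftrightarrow>
     skew_brace (structure_group_with_add X r pl) \<and>
     (\<forall>x\<in>X. \<forall>y\<in>X.
        brace_solution (structure_group_with_add X r pl) (structure_map X r x, structure_map X r y)
        = map_prod (structure_map X r) (structure_map X r) (r (x, y)))"

text \<open>
  For a (non-degenerate) solution there is exactly one such addition on the carrier of the
  structure group. Its values outside the carrier are unconstrained, hence \<open>SOME\<close> and not \<open>THE\<close>.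
\<close>

definition structure_skew_brace :: "'a set \<Rightarrow> ('a \<times> 'a \<Rightarrow> 'a \<times> 'a) \<Rightarrow> 'a word set ring" where
  "structure_skew_brace X r =
     structure_group_with_add X r (SOME pl. structure_addition X r pl)"

section \<open>Soluble solutions\<close>

text \<open>
  The type argument is the type in which the skew braces \<open>B\<^sub>0, \<dots>, B\<^sub>t\<close> live. HOL cannot quantify
  over types inside a definition; results are stated for an arbitrary such type.
  As every \<open>B\<^sub>k\<close> is an image of \<open>X\<close>, any family is isomorphic to one of this form.
  The sets \<open>K k\<close> are the i-kernels \<open>X\<^sub>k\<close>.
\<close>

definition soluble_solution :: "'b itself \<Rightarrow> 'a set \<Rightarrow> ('a \<times> 'a \<Rightarrow> 'a \<times> 'a) \<Rightarrow> bool" where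
  "soluble_solution (_ :: 'b itself) X r \<longleftrightarrow> yb_solution X r \<and>
     (\<exists>(t::nat) (B :: nat \<Rightarrow> 'b ring) (f :: nat \<Rightarrow> 'a \<Rightarrow> 'b) (K :: nat \<Rightarrow> 'a set).
        t \<ge> 1 \<and>
        (\<forall>k\<le>t. skew_brace (B k)) \<and>
        (\<forall>k\<le>t. sol_epi X r (carrier (B k)) (brace_solution (B k)) (f k)) \<and>
        (\<forall>k<t. i_kernel X r (f k) (K k)) \<and>
        X // ker_rel X (f 0) = {X} \<and>
        ker_rel X (f t) \<subseteq> ker_rel X (structure_map X r) \<and>
        (\<forall>k\<in>{1..t}.
           ker_rel X (f k) \<subseteq> ker_rel X (f (k - 1)) \<and>
           (\<exists>J. abelian_brace_ideal J (B k) \<and> f k ` K (k - 1) \<subseteq> J \<and>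
              (\<forall>(x, y) \<in> ker_rel X (f (k - 1)).
                 f k x <#\<^bsub>B k\<^esub> J = f k y <#\<^bsub>B k\<^esub> J))))"

end

theory Submission
  imports Defs "HOL-Algebra.Generated_Groups"
begin

text \<open>
  A map \<open>q\<close> between skew braces \<open>C\<close> and \<open>D\<close> that is only a homomorphism of the associated solutions
  still transports the maps \<open>\<lambda>\<^sub>a\<close> and the additive conjugations. If \<open>q(C)\<close> generates \<open>D\<close>, then
  \<open>q(ab)\<close> and \<open>q(a)q(b)\<close> induce the same such maps on all of \<open>D\<close>, that is, they agree modulo the socle
  of \<open>D\<close>. So \<open>C \<rightarrow> D / Soc(D)\<close> is an epimorphism of skew braces, and as the socle is an abelian ideal,
  solubility of \<open>C\<close> implies solubility of \<open>D\<close>. Applied to \<open>B\<^sub>k\<^sub>-\<^sub>1 \<rightarrow> B\<^sub>k / J\<close> this shows by induction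
  that every \<open>B\<^sub>k\<close> is soluble, and applied to \<open>B\<^sub>t \<rightarrow> G(X, r)\<close> it gives the theorem.
\<close>

section \<open>Skew braces\<close>

text \<open>The definition of \<open>structure_skew_brace\<close> selects its addition by
  \<open>SOME\<close>, so before anything can be said about it an addition must be shown to exist.
  The soluble solution itself provides the means: the canonical map factors through
  \<open>f t\<close>, so the structure group is generated by an image of \<open>B t\<close>, and it
  maps onto \<open>B t\<close> because its defining relations hold there. The action of the
  structure group on its generators can thus be read off in \<open>B t\<close>, and only the sum has
  to be constructed. The socle enters because the solution of a skew brace determines two actions of
  an element, its map \<lambda> and, through \<open>lam_lam_rho\<close>, its additive conjugation;
  the socle consists of the elements for which both are trivial. Both actions are by endomorphisms
  of the additive group, whereas generation is given multiplicatively, so it first has to be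
  transferred to the additive group.\<close>

sublocale skew_brace < group B
  by (rule mult_group)

sublocale skew_brace < add: group "add_monoid B"
  rewrites "carrier (add_monoid B) = carrier B"
    and "mult (add_monoid B) = add B"
    and "one (add_monoid B) = zero B"
    and "m_inv (add_monoid B) = a_inv B"
  by (rule add_group) (auto simp: a_inv_def)

context skew_brace
begin

abbreviation lam :: "'b \<Rightarrow> 'b \<Rightarrow> 'b" where "lam \<equiv> brace_lambda B"

lemma one_eq_zero [simp]: "\<one> = \<zero>"
proof -
  have "\<one> \<otimes> (\<zero> \<oplus> \<zero>) = ((\<one> \<otimes> \<zero>) \<oplus> (\<ominus> \<one>)) \<oplus> (\<one> \<otimes> \<zero>)"
    by (intro skew_distrib) auto
  then show ?thesis
    by (metis add.inv_closed add.inv_inv add.inv_one add.l_one add.one_closed add.r_one l_one one_closed)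
qed

lemma mult_zero [simp]:
  assumes "a \<in> carrier B"
  shows "a \<otimes> \<zero> = a" "\<zero> \<otimes> a = a"
  using l_one[OF assms] r_one[OF assms] by simp_all

lemma inv_zero [simp]: "inv \<zero> = \<zero>"
  using inv_one by simp

lemma lam_closed [simp, intro]:
  "\<lbrakk>a \<in> carrier B; b \<in> carrier B\<rbrakk> \<Longrightarrow> lam a b \<in> carrier B"
  by (simp add: brace_lambda_def)

lemma mult_eq_add_lam:
  "\<lbrakk>a \<in> carrier B; b \<in> carrier B\<rbrakk> \<Longrightarrow> a \<otimes> b = a \<oplus> lam a b"
  unfolding brace_lambda_def by (simp add: add.m_assoc[symmetric])

lemma lam_eqI:
  "\<lbrakk>a \<in> carrier B; b \<in> carrier B; c \<in> carrier B; a \<otimes> b = a \<oplus> c\<rbrakk> \<Longrightarrow> lam a b = c"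
  unfolding brace_lambda_def by (simp add: add.m_assoc[symmetric])

lemma mult_add:
  assumes "a \<in> carrier B" "b \<in> carrier B" "c \<in> carrier B"
  shows "a \<otimes> (b \<oplus> c) = (a \<otimes> b) \<oplus> lam a c"
  using assms by (simp add: skew_distrib brace_lambda_def add.m_assoc)

lemma lam_add:
  assumes "a \<in> carrier B" "b \<in> carrier B" "c \<in> carrier B"
  shows "lam a (b \<oplus> c) = lam a b \<oplus> lam a c"
  using assms by (intro lam_eqI) (auto simp: mult_add add.m_assoc[symmetric] mult_eq_add_lam[symmetric])

lemma lam_mult:
  assumes "a \<in> carrier B" "b \<in> carrier B" "c \<in> carrier B"
  shows "lam (a \<otimes> b) c = lam a (lam b c)"
  using assms
  by (intro lam_eqI) (auto simp: m_assoc mult_eq_add_lam[of b c] mult_add)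

lemma zero_lam [simp]: "a \<in> carrier B \<Longrightarrow> lam \<zero> a = a"
  by (rule lam_eqI) simp_all

lemma lam_inv_lam [simp]:
  "\<lbrakk>a \<in> carrier B; b \<in> carrier B\<rbrakk> \<Longrightarrow> lam (inv a) (lam a b) = b"
  by (simp add: lam_mult[symmetric])

lemma lam_lam_inv [simp]:
  "\<lbrakk>a \<in> carrier B; b \<in> carrier B\<rbrakk> \<Longrightarrow> lam a (lam (inv a) b) = b"
  by (simp add: lam_mult[symmetric])

lemma lam_zero [simp]: "a \<in> carrier B \<Longrightarrow> lam a \<zero> = \<zero>"
  by (rule lam_eqI) simp_all

lemma lam_neg: "\<lbrakk>a \<in> carrier B; b \<in> carrier B\<rbrakk> \<Longrightarrow> lam a (\<ominus> b) = \<ominus> (lam a b)"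
  by (rule add.inv_equality[symmetric]) (simp_all add: lam_add[symmetric])

lemma add_eq_mult_lam_inv:
  "\<lbrakk>a \<in> carrier B; b \<in> carrier B\<rbrakk> \<Longrightarrow> a \<oplus> b = a \<otimes> lam (inv a) b"
  by (simp add: mult_eq_add_lam)

text \<open>From \<open>\<zero> = a \<oplus> \<ominus> a = a \<otimes> lam (inv a) (\<ominus>
  a)\<close>. With this, an additive subgroup stable under the maps \<open>lam\<close> is closed
  under multiplicative inverses.\<close>

lemma inv_eq_lam_neg: "a \<in> carrier B \<Longrightarrow> inv a = lam (inv a) (\<ominus> a)"
  using add_eq_mult_lam_inv[of a "\<ominus> a"] inv_unique'[of a "lam (inv a) (\<ominus> a)"]
  by (metis add.inv_closed add.r_inv inv_closed inv_inv lam_closed one_eq_zero inv_equality)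

lemma rho_closed [simp, intro]:
  "\<lbrakk>a \<in> carrier B; b \<in> carrier B\<rbrakk> \<Longrightarrow> brace_rho B b a \<in> carrier B"
  by (simp add: brace_rho_def)

lemma lam_mult_rho:
  "\<lbrakk>a \<in> carrier B; b \<in> carrier B\<rbrakk> \<Longrightarrow> lam a b \<otimes> brace_rho B b a = a \<otimes> b"
  by (simp add: brace_rho_def m_assoc[symmetric])

text \<open>Both components of the solution together encode additive conjugation: the product
  \<open>a \<otimes> b\<close> equals \<open>a \<oplus> lam a b\<close>, and also
  \<open>lam a b \<oplus> lam (lam a b) (brace_rho B b a)\<close>.\<close>

lemma lam_lam_rho:
  assumes "a \<in> carrier B" "b \<in> carrier B"
  shows "lam (lam a b) (brace_rho B b a) = \<ominus> (lam a b) \<oplus> (a \<oplus> lam a b)"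
proof -
  have "lam a b \<oplus> lam (lam a b) (brace_rho B b a) = a \<oplus> lam a b"
    using assms by (simp add: mult_eq_add_lam[symmetric] lam_mult_rho)
  then show ?thesis
    using assms by (metis add.inv_solve_left' add.m_closed lam_closed rho_closed)
qed

end

subsection \<open>Homomorphisms\<close>

definition brace_hom :: "'b ring \<Rightarrow> 'c ring \<Rightarrow> ('b \<Rightarrow> 'c) set" where
  "brace_hom B C = hom B C \<inter> hom (add_monoid B) (add_monoid C)"

locale skew_brace_hom = B: skew_brace B + C: skew_brace C
  for B :: "'b ring" and C :: "'c ring" +
  fixes h
  assumes brace_hom: "h \<in> brace_hom B C"

sublocale skew_brace_hom < mult: group_hom B C h
  using brace_hom by unfold_locales (simp add: brace_hom_def)

sublocale skew_brace_hom < add: group_hom "add_monoid B" "add_monoid C" h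
  rewrites "carrier (add_monoid B) = carrier B"
    and "mult (add_monoid B) = add B"
    and "one (add_monoid B) = zero B"
    and "m_inv (add_monoid B) = a_inv B"
    and "carrier (add_monoid C) = carrier C"
    and "mult (add_monoid C) = add C"
    and "one (add_monoid C) = zero C"
    and "m_inv (add_monoid C) = a_inv C"
proof -
  show "group_hom (add_monoid B) (add_monoid C) h"
    using brace_hom B.add_group C.add_group
    by (simp add: brace_hom_def group_hom_def group_hom_axioms_def)
qed (auto simp: a_inv_def)

lemma (in skew_brace_hom) hom_lam:
  "\<lbrakk>a \<in> carrier B; b \<in> carrier B\<rbrakk> \<Longrightarrow> h (brace_lambda B a b) = brace_lambda C (h a) (h b)"
  by (simp add: brace_lambda_def)

subsection \<open>Ideals and quotients\<close>

locale ideal_of_brace = skew_brace B for I and B :: "'b ring" (structure) +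
  assumes brace_ideal: "brace_ideal I B"

sublocale ideal_of_brace < mult: normal I B
  using brace_ideal by (simp add: brace_ideal_def)

sublocale ideal_of_brace < add: normal I "add_monoid B"
  rewrites "carrier (add_monoid B) = carrier B"
    and "mult (add_monoid B) = add B"
    and "one (add_monoid B) = zero B"
    and "m_inv (add_monoid B) = a_inv B"
  using brace_ideal by (simp_all add: brace_ideal_def a_inv_def)

context ideal_of_brace
begin

lemma lam_in: "\<lbrakk>a \<in> carrier B; i \<in> I\<rbrakk> \<Longrightarrow> lam a i \<in> I"
  using brace_ideal by (auto simp: brace_ideal_def)

text \<open>Stability of \<open>I\<close> under \<open>lam\<close> identifies the left cosets, since
  \<open>a \<oplus> i = a \<otimes> lam (inv a) i\<close> and
  \<open>a \<otimes> i = a \<oplus> lam a i\<close>. Normality in both groups carries this over to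
  right cosets.\<close>

lemma add_rcos_eq:
  assumes a: "a \<in> carrier B"
  shows "I #>\<^bsub>add_monoid B\<^esub> a = I #> a"
proof -
  have "(\<lambda>i. a \<oplus> i) ` I = (\<lambda>i. a \<otimes> i) ` I"
  proof (intro subset_antisym image_subsetI)
    fix i assume i: "i \<in> I"
    show "a \<oplus> i \<in> (\<lambda>i. a \<otimes> i) ` I"
      using i a lam_in[of "inv a" i] by (simp add: add_eq_mult_lam_inv)
    show "a \<otimes> i \<in> (\<lambda>i. a \<oplus> i) ` I"
      using i a lam_in[of a i] by (simp add: mult_eq_add_lam)
  qed
  then have "a <#\<^bsub>add_monoid B\<^esub> I = a <# I"
    by (auto simp: l_coset_def)
  then show ?thesis
    using add.coset_eq mult.coset_eq a by simp
qed

text \<open>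
  The more-part \<open>undefined\<close> of \<open>add_monoid B\<close> has type \<open>unit\<close> here, and the simplifier would turn it
  into \<open>()\<close>, after which lemmas about \<open>add_monoid B\<close> no longer match.
\<close>

lemma add_rcosets_eq: "rcosets\<^bsub>add_monoid B\<^esub> I = rcosets I"
  using [[simproc del: unit_eq]] by (simp add: RCOSETS_def add_rcos_eq)

lemma carrier_quotient: "carrier (brace_quotient B I) = (\<lambda>a. I #> a) ` carrier B"
  by (auto simp: brace_quotient_def RCOSETS_def)

lemma group_quotient: "group (brace_quotient B I)"
  and group_add_quotient: "group (add_monoid (brace_quotient B I))"
proof -
  have "group (B Mod I)" "group (add_monoid B Mod I)"
    by (rule mult.factorgroup_is_group add.factorgroup_is_group)+
  \<comment> \<open>The quotient record is not literally a factor group of HOL-Algebra. The group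
    axioms speak only of carrier, product and unit, so unfolding them allows a comparison field by
    field.\<close>
  then show "group (brace_quotient B I)" "group (add_monoid (brace_quotient B I))"
    using [[simproc del: unit_eq]]
    unfolding group_def group_axioms_def monoid_def Units_def
    by (simp_all add: brace_quotient_def FactGroup_def add_rcosets_eq set_add_def)
qed

lemma proj_mult: 
  "\<lbrakk>a \<in> carrier B; b \<in> carrier B\<rbrakk> \<Longrightarrow>
    (I #> a) \<otimes>\<^bsub>brace_quotient B I\<^esub> (I #> b) = I #> (a \<otimes> b)"
  by (simp add: brace_quotient_def mult.rcos_sum)

lemma proj_add: 
  "\<lbrakk>a \<in> carrier B; b \<in> carrier B\<rbrakk> \<Longrightarrow>
    (I #> a) \<oplus>\<^bsub>brace_quotient B I\<^esub> (I #> b) = I #> (a \<oplus> b)"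
  using [[simproc del: unit_eq]] add.rcos_sum[of a b]
  by (simp add: brace_quotient_def set_add_def add_rcos_eq)

lemma proj_eq_iff:
  assumes "a \<in> carrier B" "b \<in> carrier B"
  shows "I #> a = I #> b \<longleftrightarrow> inv a \<otimes> b \<in> I"
proof
  assume "I #> a = I #> b"
  then have "b \<in> I #> a"
    using assms by (metis rcos_self mult.subgroup_axioms)
  then have "b \<in> a <# I"
    using assms by (simp add: mult.coset_eq)
  then show "inv a \<otimes> b \<in> I"
    using assms by (auto simp: l_coset_def m_assoc[symmetric])
next
  assume "inv a \<otimes> b \<in> I"
  then have "b \<in> a <# I"
    using assms by (intro mult.lcos_module_rev is_group)
  then show "I #> a = I #> b"
    using assms by (intro repr_independence mult.subgroup_axioms) (simp_all add: mult.coset_eq)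
qed

lemma proj_eq_zero_iff:
  assumes "a \<in> carrier B"
  shows "I #> a = \<zero>\<^bsub>brace_quotient B I\<^esub> \<longleftrightarrow> a \<in> I"
proof -
  have "I #> \<zero> = I"
    using coset_mult_one[OF mult.subset] by simp
  then have "\<zero>\<^bsub>brace_quotient B I\<^esub> = I #> \<zero>"
    by (simp add: brace_quotient_def)
  then have "I #> a = \<zero>\<^bsub>brace_quotient B I\<^esub> \<longleftrightarrow> inv a \<in> I"
    using proj_eq_iff[OF assms, of \<zero>] assms by simp
  then show ?thesis
    using assms by (metis inv_inv mult.m_inv_closed)
qed

lemma kernel_proj: "{a \<in> carrier B. I #> a = \<zero>\<^bsub>brace_quotient B I\<^esub>} = I"
proof -
  have "{a \<in> carrier B. I #> a = \<zero>\<^bsub>brace_quotient B I\<^esub>} = {a \<in> carrier B. a \<in> I}"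
    by (simp add: proj_eq_zero_iff cong: conj_cong)
  then show ?thesis
    using mult.subset by auto
qed

lemma skew_brace_quotient: "skew_brace (brace_quotient B I)"
proof (rule skew_brace.intro)
  show "group (brace_quotient B I)" "group (add_monoid (brace_quotient B I))"
    by (rule group_quotient group_add_quotient)+
  interpret Q: group "add_monoid (brace_quotient B I)"
    by (rule group_add_quotient)
  interpret add: group_hom "add_monoid B" "add_monoid (brace_quotient B I)" "\<lambda>a. I #> a"
    by unfold_locales (auto simp: hom_def carrier_quotient proj_add)
  have neg: "\<ominus>\<^bsub>brace_quotient B I\<^esub> (I #> a) = I #> \<ominus> a" if "a \<in> carrier B" for a
    using add.hom_inv[of a] that by (simp add: a_inv_def)
  fix a b c
  assume "a \<in> carrier (brace_quotient B I)" "b \<in> carrier (brace_quotient B I)"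
    "c \<in> carrier (brace_quotient B I)"
  then show "a \<otimes>\<^bsub>brace_quotient B I\<^esub> (b \<oplus>\<^bsub>brace_quotient B I\<^esub> c) =
      a \<otimes>\<^bsub>brace_quotient B I\<^esub> b \<oplus>\<^bsub>brace_quotient B I\<^esub> \<ominus>\<^bsub>brace_quotient B I\<^esub> a
        \<oplus>\<^bsub>brace_quotient B I\<^esub> a \<otimes>\<^bsub>brace_quotient B I\<^esub> c"
    by (auto simp: carrier_quotient proj_add proj_mult neg skew_distrib)
qed

sublocale proj: skew_brace_hom B "brace_quotient B I" "\<lambda>a. I #> a"
proof (intro skew_brace_hom.intro skew_brace_hom_axioms.intro)
  show "(\<lambda>a. I #> a) \<in> brace_hom B (brace_quotient B I)"
    by (auto simp: brace_hom_def hom_def carrier_quotient proj_add proj_mult)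
qed (rule skew_brace_axioms skew_brace_quotient)+

end
subsection \<open>Solubility through elementwise congruences\<close>

text \<open>The condition that \<open>I / J\<close> is an abelian skew brace, stated without quotients.\<close>

definition abelian_mod :: "'b ring \<Rightarrow> 'b set \<Rightarrow> 'b set \<Rightarrow> bool" where
  "abelian_mod B I J \<longleftrightarrow> (\<forall>a\<in>I. \<forall>b\<in>I.
     inv\<^bsub>B\<^esub> (a \<otimes>\<^bsub>B\<^esub> b) \<otimes>\<^bsub>B\<^esub> (a \<oplus>\<^bsub>B\<^esub> b) \<in> J \<and>
     inv\<^bsub>B\<^esub> (b \<otimes>\<^bsub>B\<^esub> a) \<otimes>\<^bsub>B\<^esub> (a \<otimes>\<^bsub>B\<^esub> b) \<in> J)"

text \<open>A chain of ideals of the whole skew brace from \<open>I\<close> down to zero with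
  abelian factors. The inductive form lets chains be mapped, pulled back and extended without
  handling indices.\<close>

inductive soluble_ideal :: "'b ring \<Rightarrow> 'b set \<Rightarrow> bool" for B where
  zero: "soluble_ideal B {\<zero>\<^bsub>B\<^esub>}"
| step: "\<lbrakk>soluble_ideal B J; brace_ideal I B; J \<subseteq> I; abelian_mod B I J\<rbrakk> \<Longrightarrow> soluble_ideal B I"

context skew_brace
begin

text \<open>Multiplicative closure comes for free:
  \<open>a \<otimes> b = a \<oplus> lam a b\<close>, and inverses are covered by
  \<open>inv_eq_lam_neg\<close>.\<close>

lemma brace_idealI:
  assumes "I \<subseteq> carrier B" "\<zero> \<in> I"
    and "\<And>a. a \<in> I \<Longrightarrow> \<ominus> a \<in> I" "\<And>a b. \<lbrakk>a \<in> I; b \<in> I\<rbrakk> \<Longrightarrow> a \<oplus> b \<in> I"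
    and add: "\<And>a i. \<lbrakk>a \<in> carrier B; i \<in> I\<rbrakk> \<Longrightarrow> a \<oplus> i \<oplus> \<ominus> a \<in> I"
    and mult: "\<And>a i. \<lbrakk>a \<in> carrier B; i \<in> I\<rbrakk> \<Longrightarrow> a \<otimes> i \<otimes> inv a \<in> I"
    and lam: "\<And>a i. \<lbrakk>a \<in> carrier B; i \<in> I\<rbrakk> \<Longrightarrow> lam a i \<in> I"
  shows "brace_ideal I B"
proof -
  have sub: "a \<in> carrier B" if "a \<in> I" for a
    using that assms(1) by blast
  have "subgroup I (add_monoid B)"
    using assms by (intro add.subgroupI) auto
  moreover have "subgroup I B"
  proof (rule subgroupI)
    show "inv a \<in> I" if "a \<in> I" for a
      using inv_eq_lam_neg[OF sub[OF that]] that assms sub by (metis inv_closed)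
    show "a \<otimes> b \<in> I" if "a \<in> I" "b \<in> I" for a b
      using that assms sub by (simp add: mult_eq_add_lam)
  qed (use assms in auto)
  ultimately show ?thesis
    using add mult lam unfolding brace_ideal_def
    by (intro conjI ballI image_subsetI normal_invI add.normal_invI) simp_all
qed

lemma zero_ideal: "brace_ideal {\<zero>} B"
  by (rule brace_idealI) auto

lemma add_monoid_restrict: "add_monoid (B\<lparr>carrier := I\<rparr>) = (add_monoid B)\<lparr>carrier := I\<rparr>"
  by simp

text \<open>Negation is defined by a description over the carrier, so it has to be checked that
  shrinking the carrier leaves it unchanged.\<close>

lemma restrict_neg:
  assumes "brace_ideal I B" "a \<in> I"
  shows "\<ominus>\<^bsub>B\<lparr>carrier := I\<rparr>\<^esub> a = \<ominus> a"
proof -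
  interpret ideal_of_brace I B
    using assms by unfold_locales auto
  show ?thesis
    using add.m_inv_consistent[OF add.subgroup_axioms assms(2)] by (simp add: a_inv_def)
qed

lemma restrict_lam:
  "\<lbrakk>brace_ideal I B; a \<in> I\<rbrakk> \<Longrightarrow> brace_lambda (B\<lparr>carrier := I\<rparr>) a b = lam a b"
  unfolding brace_lambda_def by (simp add: restrict_neg)

lemma skew_brace_restrict:
  assumes I: "brace_ideal I B"
  shows "skew_brace (B\<lparr>carrier := I\<rparr>)"
proof (rule skew_brace.intro)
  interpret ideal_of_brace I B
    using assms by unfold_locales auto
  show "group (B\<lparr>carrier := I\<rparr>)"
    by (rule subgroup_imp_group) (rule mult.subgroup_axioms)
  show "group (add_monoid (B\<lparr>carrier := I\<rparr>))"
    unfolding add_monoid_restrict by (rule add.subgroup_imp_group) (rule add.subgroup_axioms)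
  fix a b c
  assume abc: "a \<in> carrier (B\<lparr>carrier := I\<rparr>)" "b \<in> carrier (B\<lparr>carrier := I\<rparr>)" "c \<in> carrier (B\<lparr>carrier := I\<rparr>)"
  then have "a \<in> carrier B" "b \<in> carrier B" "c \<in> carrier B"
    using mult.subset by auto
  then show "a \<otimes>\<^bsub>B\<lparr>carrier := I\<rparr>\<^esub> (b \<oplus>\<^bsub>B\<lparr>carrier := I\<rparr>\<^esub> c) =
      a \<otimes>\<^bsub>B\<lparr>carrier := I\<rparr>\<^esub> b \<oplus>\<^bsub>B\<lparr>carrier := I\<rparr>\<^esub> \<ominus>\<^bsub>B\<lparr>carrier := I\<rparr>\<^esub> a
        \<oplus>\<^bsub>B\<lparr>carrier := I\<rparr>\<^esub> a \<otimes>\<^bsub>B\<lparr>carrier := I\<rparr>\<^esub> c"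
    using restrict_neg[OF I, of a] abc by (simp add: skew_distrib)
qed

lemma brace_ideal_restrict:
  assumes I: "brace_ideal I B" and J: "brace_ideal J B" and "J \<subseteq> I"
  shows "brace_ideal J (B\<lparr>carrier := I\<rparr>)"
proof -
  interpret I: ideal_of_brace I B
    using assms by unfold_locales auto
  interpret J: ideal_of_brace J B
    using assms by unfold_locales auto
  have "J \<lhd> B\<lparr>carrier := I\<rparr>"
    by (rule normal_restrict_supergroup[OF I.mult.subgroup_axioms J.mult.normal_axioms \<open>J \<subseteq> I\<close>])
  moreover have "J \<lhd> add_monoid (B\<lparr>carrier := I\<rparr>)"
    unfolding add_monoid_restrict
    by (rule add.normal_restrict_supergroup[OF I.add.subgroup_axioms J.add.normal_axioms \<open>J \<subseteq> I\<close>])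
  ultimately show ?thesis
    using J.lam_in I.mult.subset by (auto simp: brace_ideal_def restrict_lam[OF I])
qed

lemma abelian_quotient:
  assumes I: "brace_ideal I B" and J: "brace_ideal J B" "J \<subseteq> I" and ab: "abelian_mod B I J"
  shows "abelian_skew_brace (brace_quotient (B\<lparr>carrier := I\<rparr>) J)"
proof -
  interpret I: ideal_of_brace I B
    using assms by unfold_locales auto
  interpret S: skew_brace "B\<lparr>carrier := I\<rparr>"
    by (rule skew_brace_restrict[OF I])
  interpret J: ideal_of_brace J "B\<lparr>carrier := I\<rparr>"
    by unfold_locales (rule brace_ideal_restrict[OF I J])
  let ?Q = "brace_quotient (B\<lparr>carrier := I\<rparr>) J"
  have inv: "inv\<^bsub>B\<lparr>carrier := I\<rparr>\<^esub> a = inv a" if "a \<in> I" for a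
    by (rule m_inv_consistent[OF I.mult.subgroup_axioms that])
  have "a \<otimes>\<^bsub>?Q\<^esub> b = b \<otimes>\<^bsub>?Q\<^esub> a \<and> a \<oplus>\<^bsub>?Q\<^esub> b = a \<otimes>\<^bsub>?Q\<^esub> b"
    if ab_in: "a \<in> carrier ?Q" "b \<in> carrier ?Q" for a b
  proof -
    obtain x y where xy: "x \<in> I" "y \<in> I"
      and a: "a = J #>\<^bsub>B\<lparr>carrier := I\<rparr>\<^esub> x" and b: "b = J #>\<^bsub>B\<lparr>carrier := I\<rparr>\<^esub> y"
      using ab_in by (auto simp: J.carrier_quotient)
    show ?thesis
      unfolding a b using xy ab
        J.proj_eq_iff[of "x \<otimes> y" "x \<oplus> y"] J.proj_eq_iff[of "y \<otimes> x" "x \<otimes> y"]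
        J.proj_mult[of x y] J.proj_mult[of y x] J.proj_add[of x y]
      by (simp add: inv abelian_mod_def)
  qed
  then show ?thesis
    unfolding abelian_skew_brace_def
    using J.skew_brace_quotient J.group_quotient by (auto intro!: group.group_comm_groupI)
qed

lemma soluble_ideal_chain:
  assumes "soluble_ideal B I"
  shows "\<exists>(t::nat) f. (\<forall>k\<le>t. brace_ideal (f k) B) \<and> f 0 = I \<and> f t = {\<zero>} \<and>
    (\<forall>k\<in>{1..t}. f k \<subseteq> f (k - 1) \<and> abelian_mod B (f (k - 1)) (f k))"
  using assms
proof (induction rule: soluble_ideal.induct)
  case zero
  show ?case
    by (rule exI[of _ 0], rule exI[of _ "\<lambda>_. {\<zero>}"]) (simp add: zero_ideal)
next
  case (step J I)
  then obtain t :: nat and f where f: "\<forall>k\<le>t. brace_ideal (f k) B" "f 0 = J" "f t = {\<zero>}"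
    "\<And>k. k\<in>{1..t} \<Longrightarrow> f k \<subseteq> f (k - 1) \<and> abelian_mod B (f (k - 1)) (f k)"
    by blast
  \<comment> \<open>Putting \<open>I\<close> in front of the chain of \<open>J\<close> creates one
    new link, at \<open>k = 1\<close>; every other link is one of \<open>f\<close> with its index
    raised by one.\<close>
  let ?g = "case_nat I f"
  have "?g k \<subseteq> ?g (k - 1) \<and> abelian_mod B (?g (k - 1)) (?g k)" if k: "k \<in> {1..Suc t}" for k
  proof (cases "k = 1")
    case True
    then show ?thesis using step f by simp
  next
    case False
    then obtain m where "k = Suc (Suc m)" "Suc m \<le> t"
      using k by (cases k; cases "k - 1") auto
    then show ?thesis using f(4)[of "Suc m"] by simp
  qed
  moreover have "\<forall>k\<le>Suc t. brace_ideal (?g k) B"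
    using f step by (auto split: nat.split)
  ultimately show ?case
    using f by (intro exI[of _ "Suc t"] exI[of _ ?g]) auto
qed

theorem soluble_skew_braceI:
  assumes "soluble_ideal B (carrier B)"
  shows "soluble_skew_brace B"
proof -
  obtain t :: nat and f where f: "\<And>k. k \<le> t \<Longrightarrow> brace_ideal (f k) B" "f 0 = carrier B" "f t = {\<zero>}"
    "\<And>k. k\<in>{1..t} \<Longrightarrow> f k \<subseteq> f (k - 1) \<and> abelian_mod B (f (k - 1)) (f k)"
    using soluble_ideal_chain[OF assms] by blast
  have "abelian_skew_brace (brace_quotient (B\<lparr>carrier := f (k - 1)\<rparr>) (f k))" if "k \<in> {1..t}" for k
  proof (rule abelian_quotient)
    show "brace_ideal (f (k - 1)) B" "brace_ideal (f k) B"
      using that f(1)[of "k - 1"] f(1)[of k] by auto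
  qed (use f(4)[OF that] in auto)
  then show ?thesis
    unfolding soluble_skew_brace_def using f skew_brace_axioms
    by (intro conjI exI[of _ t] exI[of _ f]) auto
qed

end

section \<open>Ideals and soluble chains along homomorphisms of skew braces\<close>

context skew_brace_hom
begin

lemma ideal_image:
  assumes I: "brace_ideal I B" and surj: "h ` carrier B = carrier C"
  shows "brace_ideal (h ` I) C"
proof -
  interpret I: ideal_of_brace I B
    using I by unfold_locales auto
  have "h ` I \<lhd> C"
    by (rule I.mult.surj_hom_normal_subgroup[OF mult.group_hom_axioms surj])
  moreover have "h ` I \<lhd> add_monoid C"
    by (rule I.add.surj_hom_normal_subgroup[OF add.group_hom_axioms]) (simp add: surj)
  moreover have "brace_lambda C c (h i) \<in> h ` I" if ci: "c \<in> carrier C" "i \<in> I" for c i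
  proof -
    obtain b where "b \<in> carrier B" "c = h b"
      using ci surj by blast
    then show ?thesis
      using hom_lam[of b i] I.lam_in[of b i] I.mult.mem_carrier[of i] ci
      by (metis imageI)
  qed
  ultimately show ?thesis
    unfolding brace_ideal_def by blast
qed

lemma ideal_preimage:
  assumes I: "brace_ideal I C"
  shows "brace_ideal {b \<in> carrier B. h b \<in> I} B"
proof -
  interpret I: ideal_of_brace I C
    using I by unfold_locales auto
  show ?thesis
    by (intro B.brace_idealI)
      (simp_all add: subset_iff hom_lam I.mult.inv_op_closed2 I.add.inv_op_closed2 I.lam_in)
qed

lemma soluble_image:
  assumes "soluble_ideal B I" and surj: "h ` carrier B = carrier C"
  shows "soluble_ideal C (h ` I)"
  using assms(1)
proof (induction rule: soluble_ideal.induct)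
  case zero
  then show ?case by (simp add: soluble_ideal.zero)
next
  case (step J I)
  interpret I: ideal_of_brace I B
    using step by unfold_locales auto
  have "inv\<^bsub>C\<^esub> (h a \<otimes>\<^bsub>C\<^esub> h b) \<otimes>\<^bsub>C\<^esub> (h a \<oplus>\<^bsub>C\<^esub> h b) \<in> h ` J \<and>
     inv\<^bsub>C\<^esub> (h b \<otimes>\<^bsub>C\<^esub> h a) \<otimes>\<^bsub>C\<^esub> (h a \<otimes>\<^bsub>C\<^esub> h b) \<in> h ` J" if "a \<in> I" "b \<in> I" for a b
  proof -
    have "a \<in> carrier B" "b \<in> carrier B"
      using that I.mult.subset by auto
    moreover have "h (inv\<^bsub>B\<^esub> (a \<otimes>\<^bsub>B\<^esub> b) \<otimes>\<^bsub>B\<^esub> (a \<oplus>\<^bsub>B\<^esub> b)) \<in> h ` J"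
      "h (inv\<^bsub>B\<^esub> (b \<otimes>\<^bsub>B\<^esub> a) \<otimes>\<^bsub>B\<^esub> (a \<otimes>\<^bsub>B\<^esub> b)) \<in> h ` J"
      using step.hyps(4) that unfolding abelian_mod_def by blast+
    ultimately show ?thesis
      by simp
  qed
  then have "abelian_mod C (h ` I) (h ` J)"
    by (auto simp: abelian_mod_def)
  then show ?case
    using step ideal_image[OF _ surj] by (blast intro: soluble_ideal.step)
qed

text \<open>The pulled back chain stops at the kernel instead of at zero; the hypothesis
  \<open>ker\<close> supplies the one further link.\<close>

lemma soluble_preimage:
  assumes "soluble_ideal C I"
    and ker: "abelian_mod B {b \<in> carrier B. h b = \<zero>\<^bsub>C\<^esub>} {\<zero>\<^bsub>B\<^esub>}"
  shows "soluble_ideal B {b \<in> carrier B. h b \<in> I}"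
  using assms(1)
proof (induction rule: soluble_ideal.induct)
  case zero
  show ?case
    using ker ideal_preimage[OF C.zero_ideal]
    by (intro soluble_ideal.step[OF soluble_ideal.zero]) auto
next
  case (step J I)
  have "abelian_mod B {b \<in> carrier B. h b \<in> I} {b \<in> carrier B. h b \<in> J}"
    using step.hyps(4) by (auto simp: abelian_mod_def)
  then show ?case
    using step.hyps by (intro soluble_ideal.step[OF step.IH] ideal_preimage) auto
qed

lemma soluble_extension:
  assumes "soluble_ideal C (carrier C)"
    and "abelian_mod B {b \<in> carrier B. h b = \<zero>\<^bsub>C\<^esub>} {\<zero>\<^bsub>B\<^esub>}"
  shows "soluble_ideal B (carrier B)"
proof -
  have "{b \<in> carrier B. h b \<in> carrier C} = carrier B"
    by auto
  then show ?thesis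
    using soluble_preimage[OF assms] by simp
qed

end
subsection \<open>The socle\<close>

text \<open>The kernel of the action \<open>lam\<close> intersected with the centre of the additive
  group.\<close>

definition socle :: "'b ring \<Rightarrow> 'b set" where
  "socle B = {d \<in> carrier B. \<forall>x\<in>carrier B.
     brace_lambda B d x = x \<and> d \<oplus>\<^bsub>B\<^esub> x = x \<oplus>\<^bsub>B\<^esub> d}"

definition add_conj :: "'b ring \<Rightarrow> 'b \<Rightarrow> 'b \<Rightarrow> 'b" where
  "add_conj B x z = \<ominus>\<^bsub>B\<^esub> x \<oplus>\<^bsub>B\<^esub> (z \<oplus>\<^bsub>B\<^esub> x)"

context skew_brace
begin

lemma neg_add_cancel [simp]:
  assumes "a \<in> carrier B" "b \<in> carrier B"
  shows "\<ominus> a \<oplus> (a \<oplus> b) = b" "a \<oplus> (\<ominus> a \<oplus> b) = b"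
  using assms by (simp_all flip: add.m_assoc)

lemma socleD:
  assumes "d \<in> socle B"
  shows "d \<in> carrier B" "x \<in> carrier B \<Longrightarrow> lam d x = x"
    "x \<in> carrier B \<Longrightarrow> d \<oplus> x = x \<oplus> d" "x \<in> carrier B \<Longrightarrow> d \<otimes> x = d \<oplus> x"
  using assms by (auto simp: socle_def mult_eq_add_lam)

text \<open>Since \<open>lam a\<close> is an automorphism of the additive group, it preserves the
  additive centre; \<open>x\<close> is written as \<open>lam a (lam (inv a) x)\<close> to use
  this.\<close>

lemma lam_central:
  assumes "a \<in> carrier B" "c \<in> carrier B" "x \<in> carrier B"
    and "\<And>x. x \<in> carrier B \<Longrightarrow> c \<oplus> x = x \<oplus> c"
  shows "lam a c \<oplus> x = x \<oplus> lam a c"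
proof -
  have "lam a c \<oplus> x = lam a (c \<oplus> lam (inv a) x)"
    using assms(1-3) by (simp add: lam_add)
  also have "\<dots> = lam a (lam (inv a) x \<oplus> c)"
    using assms(1-3) by (simp add: assms(4)[of "lam (inv a) x"])
  also have "\<dots> = x \<oplus> lam a c"
    using assms(1-3) by (simp add: lam_add)
  finally show ?thesis .
qed

text \<open>The conjugate acts trivially because the kernel of \<open>lam\<close> is normal. Hence
  adding it to \<open>a\<close> is the same as multiplying it by \<open>a\<close>, which gives
  \<open>a \<otimes> d = a \<oplus> lam a d\<close>; as \<open>lam a d\<close> is central,
  \<open>a\<close> can be cancelled.\<close>

lemma conj_socle:
  assumes a: "a \<in> carrier B" and d: "d \<in> socle B"
  shows "a \<otimes> d \<otimes> inv a = lam a d"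
proof -
  note d' = socleD[OF d]
  have "lam (a \<otimes> d \<otimes> inv a) a = a"
    using a d' by (simp add: lam_mult)
  then have "a \<otimes> d \<otimes> inv a \<oplus> a = a \<otimes> d \<otimes> inv a \<otimes> a"
    using a d'(1) mult_eq_add_lam[of "a \<otimes> d \<otimes> inv a" a] by simp
  also have "\<dots> = a \<otimes> d"
    using a d'(1) by (simp add: m_assoc)
  also have "\<dots> = a \<oplus> lam a d"
    using a d'(1) by (rule mult_eq_add_lam)
  also have "\<dots> = lam a d \<oplus> a"
    using a d' lam_central[of a d a] by simp
  finally show ?thesis
    using a d' by simp
qed

lemma lam_socle:
  assumes a: "a \<in> carrier B" and d: "d \<in> socle B"
  shows "lam a d \<in> socle B"
proof -
  note d' = socleD[OF d]
  have "lam (lam a d) x = x" if "x \<in> carrier B" for x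
    using a d' that unfolding conj_socle[OF a d, symmetric] by (simp add: lam_mult)
  then show ?thesis
    using a d' lam_central[of a d] by (simp add: socle_def)
qed

lemma neg_socle:
  assumes d: "d \<in> socle B"
  shows "\<ominus> d \<in> socle B"
proof -
  note d' = socleD[OF d]
  \<comment> \<open>Since \<open>lam d\<close> is the identity, products with \<open>d\<close> on
    the left are sums, so the negative of \<open>d\<close> is also its multiplicative
    inverse.\<close>
  have "d \<otimes> \<ominus> d = \<one>"
    using d' by simp
  then have inv: "\<ominus> d = inv d"
    using d' by (metis add.inv_closed inv_equality inv_inv inv_closed)
  have "lam (\<ominus> d) x = x" if "x \<in> carrier B" for x
    using d'(1) d'(2)[OF that] that lam_inv_lam[of d x] by (simp add: inv)
  moreover have "\<ominus> d \<oplus> x = x \<oplus> \<ominus> d" if "x \<in> carrier B" for x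
  proof -
    have "x = \<ominus> d \<oplus> (x \<oplus> d)"
      using d' that by (metis add.inv_solve_left add.m_closed)
    then show ?thesis
      using d' that by (metis add.inv_closed add.inv_solve_right add.m_assoc add.m_closed)
  qed
  ultimately show ?thesis
    using d' by (simp add: socle_def)
qed

lemma socle_ideal: "brace_ideal (socle B) B"
proof (rule brace_idealI)
  show "a \<oplus> b \<in> socle B" if "a \<in> socle B" "b \<in> socle B" for a b
  proof -
    note a = socleD[OF that(1)] and b = socleD[OF that(2)]
    \<comment> \<open>The sum is turned back into the product \<open>a \<otimes> b\<close>, to which
      \<open>lam_mult\<close> applies.\<close>
    have "lam (a \<oplus> b) x = x" if "x \<in> carrier B" for x
      using that a(1,2) b(1,2) by (simp add: lam_mult flip: a(4))
    moreover have "a \<oplus> b \<oplus> x = x \<oplus> (a \<oplus> b)" if "x \<in> carrier B" for x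
      using that a(1,3) b(1,3) by (metis add.m_assoc)
    ultimately show ?thesis
      using a(1) b(1) by (simp add: socle_def)
  qed
  show "a \<oplus> i \<oplus> \<ominus> a \<in> socle B" if "a \<in> carrier B" "i \<in> socle B" for a i
    using that socleD(1,3)[OF that(2)] by (metis add.inv_solve_right add.m_closed)
qed (simp_all add: neg_socle conj_socle lam_socle socleD, auto simp: socle_def)

lemma socle_abelian: "abelian_mod B (socle B) {\<zero>}"
  unfolding abelian_mod_def by (auto simp: socleD)

text \<open>Equal conjugations make \<open>\<ominus> x \<oplus> y\<close> additively central, and
  \<open>inv x \<otimes> y\<close> is its image under \<open>lam (inv x)\<close>, which preserves
  the centre.\<close>

lemma socle_congI:
  assumes x: "x \<in> carrier B" and y: "y \<in> carrier B"
    and lam: "\<And>z. z \<in> carrier B \<Longrightarrow> lam x z = lam y z"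
    and conj: "\<And>z. z \<in> carrier B \<Longrightarrow> add_conj B x z = add_conj B y z"
  shows "inv x \<otimes> y \<in> socle B"
proof -
  have "lam (inv x \<otimes> y) z = z" if "z \<in> carrier B" for z
    using x y lam[OF that] that by (simp add: lam_mult flip: lam)
  moreover have "inv x \<otimes> y \<oplus> z = z \<oplus> inv x \<otimes> y" if "z \<in> carrier B" for z
  proof -
    have "\<ominus> x \<oplus> y \<oplus> z = z \<oplus> (\<ominus> x \<oplus> y)" if z: "z \<in> carrier B" for z
    proof -
      \<comment> \<open>The argument is chosen so that conjugation by \<open>x\<close> returns
        \<open>z\<close>; the hypothesis then says that conjugation by \<open>y\<close> does so as
        well.\<close>
      have "add_conj B x (x \<oplus> z \<oplus> \<ominus> x) = z"
        using x z by (simp add: add_conj_def add.m_assoc)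
      then have "\<ominus> y \<oplus> (x \<oplus> z \<oplus> \<ominus> x \<oplus> y) = z"
        using conj[of "x \<oplus> z \<oplus> \<ominus> x"] x z by (simp add: add_conj_def)
      then have "x \<oplus> z \<oplus> \<ominus> x \<oplus> y = y \<oplus> z"
        using x y z by (metis add.inv_solve_left' add.m_closed add.inv_closed)
      then have "x \<oplus> (z \<oplus> (\<ominus> x \<oplus> y)) = y \<oplus> z"
        using x y z by (simp add: add.m_assoc)
      then show ?thesis
        using x y z by (metis add.inv_solve_left' add.m_assoc add.m_closed add.inv_closed)
    qed
    moreover have "inv x \<otimes> y = lam (inv x) (\<ominus> x \<oplus> y)"
      using x y by (metis add.inv_closed inv_eq_lam_neg inv_closed lam_add mult_eq_add_lam)
    ultimately show ?thesis
      using x y that lam_central[of "inv x" "\<ominus> x \<oplus> y" z] by simp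
  qed
  ultimately show ?thesis
    using x y by (simp add: socle_def)
qed

lemma add_conj_add:
  assumes "x \<in> carrier B" "y \<in> carrier B" "z \<in> carrier B"
  shows "add_conj B (x \<oplus> y) z = add_conj B y (add_conj B x z)"
  using assms by (simp add: add_conj_def add.inv_mult_group add.m_assoc)

lemma add_conj_closed [simp, intro]:
  "\<lbrakk>x \<in> carrier B; z \<in> carrier B\<rbrakk> \<Longrightarrow> add_conj B x z \<in> carrier B"
  by (simp add: add_conj_def)

lemma add_conj_hom:
  assumes "x \<in> carrier B"
  shows "add_conj B x \<in> hom (add_monoid B) (add_monoid B)"
proof -
  have "add_conj B x (a \<oplus> b) = add_conj B x a \<oplus> add_conj B x b"
    if "a \<in> carrier B" "b \<in> carrier B" for a b
  proof -
    have "add_conj B x a \<oplus> add_conj B x b = \<ominus> x \<oplus> a \<oplus> (x \<oplus> \<ominus> x) \<oplus> b \<oplus> x"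
      unfolding add_conj_def using assms that by (simp only: add.m_assoc add.m_closed add.inv_closed)
    then show ?thesis
      using assms that by (simp add: add_conj_def add.m_assoc)
  qed
  then show ?thesis
    using assms by (auto simp: hom_def)
qed

lemma lam_hom: "a \<in> carrier B \<Longrightarrow> lam a \<in> hom (add_monoid B) (add_monoid B)"
  by (auto simp: hom_def lam_add)

end

section \<open>Homomorphisms of associated solutions with generating image\<close>

lemma hom_eq_on_generate:
  assumes "group_hom G H f" "group_hom G H g" "S \<subseteq> carrier G"
    and "\<And>s. s \<in> S \<Longrightarrow> f s = g s" and "x \<in> generate G S"
  shows "f x = g x"
proof -
  interpret f: group_hom G H f by fact
  interpret g: group_hom G H g by fact
  have closed: "y \<in> carrier G" if "y \<in> generate G S" for y
    using that assms(3) f.G.generate_in_carrier by blast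
  show ?thesis
    using assms(5)
  proof (induction rule: generate.induct)
    case (inv h)
    then show ?case using assms(3,4) by (metis f.hom_inv g.hom_inv subsetD)
  qed (use assms(4) closed in auto)
qed

text \<open>Generation is required instead of surjectivity because the image of the canonical map is
  in general only a generating set of the structure group.\<close>

locale brace_solution_hom = C: skew_brace C + D: skew_brace D
  for C :: "'c ring" and D :: "'d ring" +
  fixes q
  assumes sol_hom: "sol_hom (carrier C) (brace_solution C) (carrier D) (brace_solution D) q"
    and generates: "generate D (q ` carrier C) = carrier D"
begin

lemma closed [simp, intro]: "c \<in> carrier C \<Longrightarrow> q c \<in> carrier D"
  using sol_hom by (auto simp: sol_hom_def)

lemma map_lam:
  assumes "a \<in> carrier C" "b \<in> carrier C"
  shows "q (brace_lambda C a b) = brace_lambda D (q a) (q b)"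
    and map_rho: "q (brace_rho C b a) = brace_rho D (q b) (q a)"
  using sol_hom assms by (auto simp: sol_hom_def brace_solution_def)

text \<open>By \<open>lam_lam_rho\<close> the conjugate is \<open>lam y (brace_rho C x a)\<close> as
  soon as \<open>lam a x = y\<close>, and \<open>q\<close> commutes with both components of the
  solution. The element \<open>x\<close> solves this equation.\<close>

lemma map_add_conj:
  assumes "y \<in> carrier C" "a \<in> carrier C"
  shows "q (add_conj C y a) = add_conj D (q y) (q a)"
proof -
  define x where "x = brace_lambda C (inv\<^bsub>C\<^esub> a) y"
  have x: "x \<in> carrier C" "brace_lambda C a x = y"
    using assms by (simp_all add: x_def)
  have qy: "brace_lambda D (q a) (q x) = q y"
    using map_lam[of a x] x assms by simp
  have "q (add_conj C y a) = q (brace_lambda C y (brace_rho C x a))"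
    using C.lam_lam_rho[of a x] x assms by (simp add: add_conj_def)
  also have "\<dots> = brace_lambda D (q y) (brace_rho D (q x) (q a))"
    using x assms by (simp add: map_lam map_rho)
  also have "\<dots> = add_conj D (q y) (q a)"
    using D.lam_lam_rho[of "q a" "q x"] x assms by (simp add: add_conj_def qy)
  finally show ?thesis .
qed

lemma lam_image:
  assumes "d \<in> carrier D" "c \<in> carrier C"
  shows "brace_lambda D d (q c) \<in> q ` carrier C"
proof -
  \<comment> \<open>All \<open>c\<close> are treated at once because for a product the inner factor
    first moves \<open>q c\<close> to another point of the image. Membership of \<open>d\<close> is
    carried along for \<open>lam_mult\<close>.\<close>
  have "\<forall>c\<in>carrier C. d \<in> carrier D \<and> brace_lambda D d (q c) \<in> q ` carrier C"
    if "d \<in> generate D (q ` carrier C)" for d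
    using that
  proof (induction rule: generate.induct)
    case (incl h)
    then obtain b where b: "b \<in> carrier C" "h = q b" by blast
    then show ?case
      by (auto simp: map_lam[symmetric])
  next
    case (inv h)
    then obtain b where b: "b \<in> carrier C" "h = q b" by blast
    have "brace_lambda D (inv\<^bsub>D\<^esub> h) (q c) = q (brace_lambda C (inv\<^bsub>C\<^esub> b) c)" if "c \<in> carrier C" for c
    proof -
      have "q c = brace_lambda D h (q (brace_lambda C (inv\<^bsub>C\<^esub> b) c))"
        using b that by (simp add: map_lam[symmetric])
      then show ?thesis
        using b that by simp
    qed
    then show ?case
      using b by auto
  next
    case (eng h1 h2)
    have "brace_lambda D (h1 \<otimes>\<^bsub>D\<^esub> h2) (q c) \<in> q ` carrier C" if c: "c \<in> carrier C" for c
    proof -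
      obtain c' where "c' \<in> carrier C" "brace_lambda D h2 (q c) = q c'"
        using eng.IH(2) c by blast
      then show ?thesis
        using eng.IH c by (auto simp: D.lam_mult)
    qed
    then show ?case
      using eng.IH by auto
  qed auto
  then show ?thesis
    using assms generates by blast
qed

text \<open>The additive subgroup generated by the image is stable under every
  \<open>brace_lambda D d\<close>, because the image is. It is therefore closed under products and
  contains the inverses of the generators, so multiplicative generation already fills
  \<open>D\<close>.\<close>

lemma add_generates: "generate (add_monoid D) (q ` carrier C) = carrier D"
proof -
  let ?A = "generate (add_monoid D) (q ` carrier C)"
  have A: "?A \<subseteq> carrier D"
    using D.add.generate_in_carrier[of "q ` carrier C"] by auto
  have lam: "brace_lambda D d a \<in> ?A" if "d \<in> carrier D" "a \<in> ?A" for d a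
  proof -
    interpret lam: group_hom "add_monoid D" "add_monoid D" "brace_lambda D d"
      using D.lam_hom[OF that(1)] by unfold_locales simp
    have "brace_lambda D d ` ?A = generate (add_monoid D) (brace_lambda D d ` (q ` carrier C))"
      by (rule lam.generate_img[symmetric]) auto
    also have "\<dots> \<subseteq> ?A"
      using lam_image[OF that(1)] by (intro D.add.mono_generate) auto
    finally show ?thesis
      using that(2) by blast
  qed
  have "d \<in> ?A" if "d \<in> generate D (q ` carrier C)" for d
    using that
  proof (induction rule: generate.induct)
    case one
    then show ?case
      using generate.one[of "add_monoid D"] by simp
  next
    case (incl h)
    then show ?case by (rule generate.incl)
  next
    case (inv h)
    then have "\<ominus>\<^bsub>D\<^esub> h \<in> ?A"
      using generate.inv[of h "q ` carrier C" "add_monoid D"] by (simp add: a_inv_def)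
    then show ?case
      using inv lam[of "inv\<^bsub>D\<^esub> h" "\<ominus>\<^bsub>D\<^esub> h"] D.inv_eq_lam_neg[of h] by auto
  next
    case (eng h1 h2)
    then have "h1 \<oplus>\<^bsub>D\<^esub> brace_lambda D h1 h2 \<in> ?A"
      using generate.eng[of h1 "add_monoid D" "q ` carrier C" "brace_lambda D h1 h2"] lam[of h1 h2] A
      by auto
    then show ?case
      using eng A by (simp add: D.mult_eq_add_lam subset_iff)
  qed
  then show ?thesis
    using A generates by blast
qed

lemma hom_eqI:
  assumes "f \<in> hom (add_monoid D) (add_monoid D)" "g \<in> hom (add_monoid D) (add_monoid D)"
    and "\<And>c. c \<in> carrier C \<Longrightarrow> f (q c) = g (q c)" and "z \<in> carrier D"
  shows "f z = g z"
proof (rule hom_eq_on_generate[where G = "add_monoid D" and H = "add_monoid D"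
      and S = "q ` carrier C" and x = z])
  show "group_hom (add_monoid D) (add_monoid D) f" "group_hom (add_monoid D) (add_monoid D) g"
    using assms(1,2) D.add_group by (simp_all add: group_hom_def group_hom_axioms_def)
  show "z \<in> generate (add_monoid D) (q ` carrier C)"
    unfolding add_generates by (rule assms(4))
  show "q ` carrier C \<subseteq> carrier (add_monoid D)"
    by auto
  show "f s = g s" if "s \<in> q ` carrier C" for s
    using that by (elim imageE) (simp add: assms(3))
qed

lemma map_mult:
  assumes "a \<in> carrier C" "b \<in> carrier C"
  shows "inv\<^bsub>D\<^esub> (q (a \<otimes>\<^bsub>C\<^esub> b)) \<otimes>\<^bsub>D\<^esub> (q a \<otimes>\<^bsub>D\<^esub> q b) \<in> socle D"
proof (rule D.socle_congI)
  show "brace_lambda D (q (a \<otimes>\<^bsub>C\<^esub> b)) z = brace_lambda D (q a \<otimes>\<^bsub>D\<^esub> q b) z"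
    if "z \<in> carrier D" for z
  proof (rule hom_eqI[OF _ _ _ that])
    show "brace_lambda D (q (a \<otimes>\<^bsub>C\<^esub> b)) (q c) = brace_lambda D (q a \<otimes>\<^bsub>D\<^esub> q b) (q c)"
      if "c \<in> carrier C" for c
      using assms that by (simp add: map_lam[symmetric] C.lam_mult D.lam_mult)
  qed (rule D.lam_hom; use assms in simp)+
  show "add_conj D (q (a \<otimes>\<^bsub>C\<^esub> b)) z = add_conj D (q a \<otimes>\<^bsub>D\<^esub> q b) z"
    if "z \<in> carrier D" for z
  proof (rule hom_eqI[OF _ _ _ that])
    \<comment> \<open>Products become sums: \<open>q a \<otimes> q b\<close> is
      \<open>q a \<oplus> q (lam a b)\<close>, just as \<open>a \<otimes> b\<close> is
      \<open>a \<oplus> lam a b\<close>. So both sides are the conjugation by \<open>q a\<close>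
      followed by that by \<open>q (lam a b)\<close>.\<close>
    show "add_conj D (q (a \<otimes>\<^bsub>C\<^esub> b)) (q c) = add_conj D (q a \<otimes>\<^bsub>D\<^esub> q b) (q c)"
      if "c \<in> carrier C" for c
      using assms that
      by (simp add: D.mult_eq_add_lam C.mult_eq_add_lam D.add_conj_add C.add_conj_add
          map_lam[symmetric] map_add_conj[symmetric])
  qed (rule D.add_conj_hom; use assms in simp)+
qed (use assms in auto)

sublocale S: ideal_of_brace "socle D" D
  by unfold_locales (rule D.socle_ideal)

abbreviation q_socle :: "'c \<Rightarrow> 'd set" where
  "q_socle c \<equiv> socle D #>\<^bsub>D\<^esub> q c"

abbreviation D_socle :: "'d set ring" where
  "D_socle \<equiv> brace_quotient D (socle D)"

lemma q_socle_mult: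
  assumes "a \<in> carrier C" "b \<in> carrier C"
  shows "q_socle (a \<otimes>\<^bsub>C\<^esub> b) = q_socle a \<otimes>\<^bsub>D_socle\<^esub> q_socle b"
proof -
  have "q_socle (a \<otimes>\<^bsub>C\<^esub> b) = socle D #>\<^bsub>D\<^esub> (q a \<otimes>\<^bsub>D\<^esub> q b)"
    by (rule iffD2[OF S.proj_eq_iff map_mult[OF assms]]) (use assms in auto)
  then show ?thesis
    using assms by simp
qed

text \<open>Multiplicativity suffices: with \<open>c = lam (inv a) b\<close> the sum in
  \<open>C\<close> is \<open>a \<otimes> c\<close>, and \<open>q a \<otimes> q c = q a \<oplus> q
  (lam a c) = q a \<oplus> q b\<close> holds exactly in \<open>D\<close>.\<close>

lemma q_socle_add:
  assumes "a \<in> carrier C" "b \<in> carrier C"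
  shows "q_socle (a \<oplus>\<^bsub>C\<^esub> b) = q_socle a \<oplus>\<^bsub>D_socle\<^esub> q_socle b"
proof -
  let ?c = "brace_lambda C (inv\<^bsub>C\<^esub> a) b"
  have "q_socle (a \<oplus>\<^bsub>C\<^esub> b) = socle D #>\<^bsub>D\<^esub> (q a \<otimes>\<^bsub>D\<^esub> q ?c)"
    using assms by (simp add: C.add_eq_mult_lam_inv q_socle_mult)
  also have "q a \<otimes>\<^bsub>D\<^esub> q ?c = q a \<oplus>\<^bsub>D\<^esub> q b"
    using assms by (simp add: D.mult_eq_add_lam flip: map_lam)
  finally show ?thesis
    using assms by simp
qed

sublocale Q: skew_brace_hom C D_socle q_socle
proof (intro skew_brace_hom.intro skew_brace_hom_axioms.intro)
  show "q_socle \<in> brace_hom C D_socle"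
    by (auto simp: brace_hom_def hom_def S.carrier_quotient q_socle_add q_socle_mult)
qed (rule C.skew_brace_axioms S.skew_brace_quotient)+

text \<open>The image of the homomorphism \<open>q_socle\<close> is a subgroup, and it contains the
  classes of a generating set of \<open>D\<close>.\<close>

lemma q_socle_surj: "q_socle ` carrier C = carrier D_socle"
proof -
  have "socle D #>\<^bsub>D\<^esub> d \<in> q_socle ` carrier C" if "d \<in> generate D (q ` carrier C)" for d
  proof -
    have sub: "q ` carrier C \<subseteq> carrier D"
      by auto
    have "(\<lambda>d. socle D #>\<^bsub>D\<^esub> d) ` generate D (q ` carrier C)
        = generate D_socle ((\<lambda>d. socle D #>\<^bsub>D\<^esub> d) ` (q ` carrier C))"
      by (rule S.proj.mult.generate_img[OF sub, symmetric])
    also have "\<dots> = q_socle ` generate C (carrier C)"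
      using Q.mult.generate_img[of "carrier C"] by (simp add: image_image)
    finally have "socle D #>\<^bsub>D\<^esub> d \<in> q_socle ` generate C (carrier C)"
      using that by (metis imageI)
    then show ?thesis
      using image_mono[OF C.generate_incl[OF subset_refl], of q_socle] by (rule subsetD[rotated])
  qed
  then show ?thesis
    using generates S.carrier_quotient by auto
qed

theorem soluble_target:
  assumes "soluble_ideal C (carrier C)"
  shows "soluble_ideal D (carrier D)"
proof (rule S.proj.soluble_extension)
  show "soluble_ideal D_socle (carrier D_socle)"
    by (rule Q.soluble_image[OF assms q_socle_surj, unfolded q_socle_surj])
  show "abelian_mod D {b \<in> carrier D. socle D #>\<^bsub>D\<^esub> b = \<zero>\<^bsub>D_socle\<^esub>} {\<zero>\<^bsub>D\<^esub>}"
    unfolding S.kernel_proj by (rule D.socle_abelian)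
qed

end
section \<open>Extending a skew brace along a presentation of its solution\<close>

text \<open>
  The additive group is obtained as a regular permutation group: right addition of \<open>j x\<close> has to be
  the map \<open>shift x\<close>, and a permutation of \<open>G\<close> that lies over a right translation of \<open>B\<close> and permutes
  the maps \<open>shift x\<close> in the way additive conjugation does is determined by its value at one point.
\<close>

locale brace_cover = B: skew_brace B + G: group G
  for B :: "'b ring" and G :: "'g monoid" (structure) +
  fixes \<pi> :: "'g \<Rightarrow> 'b" and j :: "'b \<Rightarrow> 'g"
  assumes hom: "\<pi> \<in> hom G B"
    and j_closed [simp, intro]: "x \<in> carrier B \<Longrightarrow> j x \<in> carrier G"
    and \<pi>_j [simp]: "x \<in> carrier B \<Longrightarrow> \<pi> (j x) = x"
    and j_relation: "\<lbrakk>x \<in> carrier B; y \<in> carrier B\<rbrakk> \<Longrightarrow>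
      j x \<otimes> j y = j (brace_lambda B x y) \<otimes> j (brace_rho B y x)"
    and generated: "generate G (j ` carrier B) = carrier G"

sublocale brace_cover < hom: group_hom G B \<pi>
  using hom by unfold_locales

section \<open>Right addition of generators\<close>

context brace_cover
begin

text \<open>The intended sum of \<open>g\<close> and \<open>j x\<close>, modelled on
  \<open>add_eq_mult_lam_inv\<close>; the action of \<open>g\<close> on the generators is computed
  in \<open>B\<close> through \<open>\<pi>\<close>.\<close>

definition shift :: "'b \<Rightarrow> 'g \<Rightarrow> 'g" where
  "shift x g = g \<otimes> j (brace_lambda B (inv\<^bsub>B\<^esub> (\<pi> g)) x)"

text \<open>The inverse of \<open>shift x\<close>. The factor to be removed depends on the value of
  \<open>\<pi>\<close> at the result, which is \<open>\<pi> g\<close> minus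
  \<open>x\<close>.\<close>

definition unshift :: "'b \<Rightarrow> 'g \<Rightarrow> 'g" where
  "unshift x g = g \<otimes> inv (j (brace_lambda B (inv\<^bsub>B\<^esub> (\<pi> g \<oplus>\<^bsub>B\<^esub> \<ominus>\<^bsub>B\<^esub> x)) x))"

lemma shift_closed [simp, intro]: "\<lbrakk>x \<in> carrier B; g \<in> carrier G\<rbrakk> \<Longrightarrow> shift x g \<in> carrier G"
  by (simp add: shift_def)

lemma unshift_closed [simp, intro]: "\<lbrakk>x \<in> carrier B; g \<in> carrier G\<rbrakk> \<Longrightarrow> unshift x g \<in> carrier G"
  by (simp add: unshift_def)

lemma \<pi>_shift [simp]: "\<lbrakk>x \<in> carrier B; g \<in> carrier G\<rbrakk> \<Longrightarrow> \<pi> (shift x g) = \<pi> g \<oplus>\<^bsub>B\<^esub> x"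
  by (simp add: shift_def B.add_eq_mult_lam_inv)

lemma \<pi>_unshift [simp]:
  assumes "x \<in> carrier B" "g \<in> carrier G"
  shows "\<pi> (unshift x g) = \<pi> g \<oplus>\<^bsub>B\<^esub> \<ominus>\<^bsub>B\<^esub> x"
proof -
  let ?p = "\<pi> g \<oplus>\<^bsub>B\<^esub> \<ominus>\<^bsub>B\<^esub> x"
  have "\<pi> g = ?p \<otimes>\<^bsub>B\<^esub> brace_lambda B (inv\<^bsub>B\<^esub> ?p) x"
    using assms by (simp add: B.mult_eq_add_lam B.add.m_assoc)
  moreover have "\<pi> (unshift x g) = \<pi> g \<otimes>\<^bsub>B\<^esub> inv\<^bsub>B\<^esub> (brace_lambda B (inv\<^bsub>B\<^esub> ?p) x)"
    using assms by (simp add: unshift_def)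
  ultimately show ?thesis
    using assms by (metis B.add.inv_closed B.add.m_closed B.inv_closed B.inv_solve_right'
        B.lam_closed hom.hom_closed)
qed

lemma shift_unshift [simp]:
  assumes "x \<in> carrier B" "g \<in> carrier G"
  shows "shift x (unshift x g) = g"
  using assms unfolding shift_def[of x "unshift x g"] \<pi>_unshift[OF assms]
  by (simp add: unshift_def G.m_assoc)

lemma unshift_shift [simp]:
  assumes "x \<in> carrier B" "g \<in> carrier G"
  shows "unshift x (shift x g) = g"
proof -
  have "\<pi> (shift x g) \<oplus>\<^bsub>B\<^esub> \<ominus>\<^bsub>B\<^esub> x = \<pi> g"
    using assms by (simp add: B.add.m_assoc)
  then show ?thesis
    using assms by (simp add: unshift_def del: \<pi>_shift) (simp add: shift_def G.m_assoc)
qed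

text \<open>This is the rule g + x + y = g + y + (-y + x + y). After removing \<open>g\<close> it is
  an instance of \<open>j_relation\<close>, in which \<open>lam_lam_rho\<close> identifies the
  second component with the conjugate.\<close>

lemma shift_shift:
  assumes "x \<in> carrier B" "y \<in> carrier B" "g \<in> carrier G"
  shows "shift y (shift x g) = shift (add_conj B y x) (shift y g)"
proof -
  let ?p = "\<pi> g"
  let ?u = "brace_lambda B (inv\<^bsub>B\<^esub> ?p) x" and ?w = "brace_lambda B (inv\<^bsub>B\<^esub> ?p) y"
  \<comment> \<open>Chosen so that \<open>brace_lambda B ?u ?v = ?w\<close>, which makes
    \<open>j ?w\<close> the first factor on the right of \<open>j_relation\<close>.\<close>
  let ?v = "brace_lambda B (inv\<^bsub>B\<^esub> ?u) ?w"
  have lam: "brace_lambda B (inv\<^bsub>B\<^esub> (?p \<oplus>\<^bsub>B\<^esub> a)) b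
      = brace_lambda B (inv\<^bsub>B\<^esub> (brace_lambda B (inv\<^bsub>B\<^esub> ?p) a)) (brace_lambda B (inv\<^bsub>B\<^esub> ?p) b)"
    if "a \<in> carrier B" "b \<in> carrier B" for a b
    using that assms by (simp add: B.add_eq_mult_lam_inv B.inv_mult_group B.lam_mult)
  have "shift y (shift x g) = g \<otimes> (j ?u \<otimes> j ?v)"
    unfolding shift_def[of y] using assms
    by (simp add: lam) (simp add: shift_def G.m_assoc)
  also have "j ?u \<otimes> j ?v = j ?w \<otimes> j (brace_rho B ?v ?u)"
    using j_relation[of ?u ?v] assms by simp
  also have "brace_rho B ?v ?u = brace_lambda B (inv\<^bsub>B\<^esub> ?w) (add_conj B ?w ?u)"
  proof -
    have "brace_lambda B ?w (brace_rho B ?v ?u) = add_conj B ?w ?u"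
      using B.lam_lam_rho[of ?u ?v] assms by (simp add: add_conj_def)
    then show ?thesis
      using assms B.lam_inv_lam[of ?w "brace_rho B ?v ?u"] by simp
  qed
  also have "add_conj B ?w ?u = brace_lambda B (inv\<^bsub>B\<^esub> ?p) (add_conj B y x)"
    using assms by (simp add: add_conj_def B.lam_add B.lam_neg)
  also have "g \<otimes> (j ?w \<otimes> j (brace_lambda B (inv\<^bsub>B\<^esub> ?w) \<dots>)) = shift (add_conj B y x) (shift y g)"
    unfolding shift_def[of "add_conj B y x"] using assms
    by (simp add: lam) (simp add: shift_def G.m_assoc)
  finally show ?thesis .
qed

text \<open>Right multiplication by a generator or its inverse is a shift or unshift whose index
  varies with the point, and the generators reach \<open>g\<close> from any
  \<open>g0\<close>.\<close>

lemma shift_induct [consumes 2, case_names start shift unshift]: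
  assumes "g0 \<in> carrier G" "g \<in> carrier G"
    and "P g0"
    and shift: "\<And>x g. \<lbrakk>x \<in> carrier B; g \<in> carrier G; P g\<rbrakk> \<Longrightarrow> P (shift x g)"
    and unshift: "\<And>x g. \<lbrakk>x \<in> carrier B; g \<in> carrier G; P g\<rbrakk> \<Longrightarrow> P (unshift x g)"
  shows "P g"
proof -
  have "\<forall>g\<in>carrier G. P g \<longrightarrow> P (g \<otimes> h)" if "h \<in> generate G (j ` carrier B)" for h
    using that
  proof (induction rule: generate.induct)
    case one
    then show ?case by simp
  next
    case (incl h)
    then obtain x where x: "x \<in> carrier B" "h = j x" by blast
    have "g \<otimes> h = shift (brace_lambda B (\<pi> g) x) g" if "g \<in> carrier G" for g
      using that x by (simp add: shift_def)
    then show ?case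
      using shift x by simp
  next
    case (inv h)
    then obtain x where x: "x \<in> carrier B" "h = j x" by blast
    \<comment> \<open>The index is computed at the end point, because the matching shift starts
      there and leads back to \<open>g\<close>.\<close>
    have "g \<otimes> inv h = unshift (brace_lambda B (\<pi> (g \<otimes> inv h)) x) g" if "g \<in> carrier G" for g
    proof -
      let ?k = "g \<otimes> inv h"
      have "shift (brace_lambda B (\<pi> ?k) x) ?k = g"
        using that x by (simp add: shift_def G.m_assoc del: hom.hom_mult)
      then show ?thesis
        using that x unshift_shift[of "brace_lambda B (\<pi> ?k) x" ?k] by simp
    qed
    then show ?case
      using unshift x by simp
  next
    case (eng h1 h2)
    have "j ` carrier B \<subseteq> carrier G" by auto
    then have "h1 \<in> carrier G" "h2 \<in> carrier G"
      using eng.hyps G.generate_in_carrier by blast+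
    then show ?case
      using eng.IH by (simp flip: G.m_assoc)
  qed
  then have "P (g0 \<otimes> (inv g0 \<otimes> g))"
    using assms(1-3) generated by simp
  then show ?thesis
    using assms(1,2) by (simp flip: G.m_assoc)
qed

text \<open>The last clause is the law (g + x) + h = (g + h) + (-b + x + b) for an element h over b,
  with \<open>p\<close> in the role of adding h on the right.\<close>

definition translation :: "'b \<Rightarrow> ('g \<Rightarrow> 'g) \<Rightarrow> bool" where
  "translation b p \<longleftrightarrow> b \<in> carrier B \<and> p \<in> carrier G \<rightarrow> carrier G \<and>
     (\<forall>g\<in>carrier G. \<pi> (p g) = \<pi> g \<oplus>\<^bsub>B\<^esub> b) \<and>
     (\<forall>g\<in>carrier G. \<forall>x\<in>carrier B. p (shift x g) = shift (add_conj B b x) (p g))"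

lemma translation_closed: "\<lbrakk>translation b p; g \<in> carrier G\<rbrakk> \<Longrightarrow> p g \<in> carrier G"
  by (auto simp: translation_def)

lemma translation_shift: "x \<in> carrier B \<Longrightarrow> translation x (shift x)"
  unfolding translation_def by (intro conjI ballI shift_shift Pi_I) simp_all

lemma translation_comp:
  "\<lbrakk>translation b p; translation c q\<rbrakk> \<Longrightarrow> translation (c \<oplus>\<^bsub>B\<^esub> b) (p \<circ> q)"
  by (auto simp: translation_def B.add_conj_add B.add.m_assoc Pi_iff)

lemma translation_id: "translation \<zero>\<^bsub>B\<^esub> (\<lambda>g. g)"
  by (auto simp: translation_def add_conj_def)

text \<open>Comparing images under \<open>\<pi>\<close> at \<open>g0\<close> gives
  \<open>b = c\<close>. The rule for shifts then carries the agreement from \<open>g0\<close> to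
  every point.\<close>

lemma translation_eqI:
  assumes p: "translation b p" and q: "translation c q"
    and eq: "g0 \<in> carrier G" "p g0 = q g0" and g: "g \<in> carrier G"
  shows "p g = q g"
proof -
  have bc: "b \<in> carrier B" "c \<in> carrier B"
    using p q by (auto simp: translation_def)
  have "\<pi> g0 \<oplus>\<^bsub>B\<^esub> b = \<pi> g0 \<oplus>\<^bsub>B\<^esub> c"
    using p q eq by (metis translation_def)
  then have "b = c"
    using bc eq(1) by (metis B.neg_add_cancel(1) hom.hom_closed)
  show ?thesis
    using eq(1) g
  proof (induction rule: shift_induct)
    case (shift x g)
    then show ?case
      using p q \<open>b = c\<close> by (simp add: translation_def)
  next
    case (unshift x g)
    let ?y = "add_conj B b x" and ?h = "unshift x g"
    have "shift ?y (p ?h) = p g" "shift ?y (q ?h) = q g"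
      using p q \<open>b = c\<close> unshift shift_unshift[of x g] by (metis translation_def unshift_closed)+
    moreover have "p ?h \<in> carrier G" "q ?h \<in> carrier G" "?y \<in> carrier B"
      using p q unshift bc by (auto simp: translation_def)
    ultimately show ?case
      using unshift.IH by (metis unshift_shift)
  qed (rule eq(2))
qed

lemma translation_unshift:
  assumes x: "x \<in> carrier B"
  shows "translation (\<ominus>\<^bsub>B\<^esub> x) (unshift x)"
proof -
  have "unshift x (shift y g) = shift (add_conj B (\<ominus>\<^bsub>B\<^esub> x) y) (unshift x g)"
    if y: "y \<in> carrier B" and g: "g \<in> carrier G" for y g
  proof -
    let ?z = "add_conj B (\<ominus>\<^bsub>B\<^esub> x) y"
    have "add_conj B x ?z = y"
      using x y B.add_conj_add[of "\<ominus>\<^bsub>B\<^esub> x" x y] by (simp add: add_conj_def)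
    then have "shift x (shift ?z (unshift x g)) = shift y g"
      using shift_shift[of ?z x "unshift x g"] x y g by simp
    then show ?thesis
      using x y g unshift_shift[of x "shift ?z (unshift x g)"] by simp
  qed
  then show ?thesis
    using x by (auto simp: translation_def)
qed

text \<open>A translation moving \<open>\<one>\<close> to \<open>g\<close> is composed of shifts and
  unshifts. The reverse translation \<open>q\<close> is built alongside it and later yields additive
  inverses.\<close>

lemma translation_exists:
  assumes "g \<in> carrier G"
  shows "\<exists>b p q. translation b p \<and> p \<one> = g \<and> translation (\<ominus>\<^bsub>B\<^esub> b) q \<and> q g = \<one>"
  using G.one_closed assms
proof (induction rule: shift_induct)
  case start
  show ?case
    using translation_id by (intro exI[of _ "\<zero>\<^bsub>B\<^esub>"] exI[of _ "\<lambda>g. g"]) simp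
next
  case (shift x g)
  then obtain b p q where p: "translation b p" "p \<one> = g" and q: "translation (\<ominus>\<^bsub>B\<^esub> b) q" "q g = \<one>"
    by blast
  have neg: "\<ominus>\<^bsub>B\<^esub> (b \<oplus>\<^bsub>B\<^esub> x) = \<ominus>\<^bsub>B\<^esub> x \<oplus>\<^bsub>B\<^esub> \<ominus>\<^bsub>B\<^esub> b"
    using p shift by (simp add: translation_def B.add.inv_mult_group)
  show ?case
  proof (intro exI conjI)
    show "translation (b \<oplus>\<^bsub>B\<^esub> x) (shift x \<circ> p)"
      by (rule translation_comp[OF translation_shift[OF shift(1)] p(1)])
    show "translation (\<ominus>\<^bsub>B\<^esub> (b \<oplus>\<^bsub>B\<^esub> x)) (q \<circ> unshift x)"
      unfolding neg by (rule translation_comp[OF q(1) translation_unshift[OF shift(1)]])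
  qed (use shift p q in simp_all)
next
  case (unshift x g)
  then obtain b p q where p: "translation b p" "p \<one> = g" and q: "translation (\<ominus>\<^bsub>B\<^esub> b) q" "q g = \<one>"
    by blast
  have neg: "\<ominus>\<^bsub>B\<^esub> (b \<oplus>\<^bsub>B\<^esub> \<ominus>\<^bsub>B\<^esub> x) = x \<oplus>\<^bsub>B\<^esub> \<ominus>\<^bsub>B\<^esub> b"
    using p unshift by (simp add: translation_def B.add.inv_mult_group)
  show ?case
  proof (intro exI conjI)
    show "translation (b \<oplus>\<^bsub>B\<^esub> \<ominus>\<^bsub>B\<^esub> x) (unshift x \<circ> p)"
      by (rule translation_comp[OF translation_unshift[OF unshift(1)] p(1)])
    show "translation (\<ominus>\<^bsub>B\<^esub> (b \<oplus>\<^bsub>B\<^esub> \<ominus>\<^bsub>B\<^esub> x)) (q \<circ> shift x)"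
      unfolding neg by (rule translation_comp[OF q(1) translation_shift[OF unshift(1)]])
  qed (use unshift p q in simp_all)
qed

text \<open>The sum with \<open>h\<close> as right summand: \<open>right_add h g\<close> stands for
  g + h. On the carrier the choice is determined, by \<open>translation_eqI\<close> at
  \<open>\<one>\<close>.\<close>

definition right_add :: "'g \<Rightarrow> 'g \<Rightarrow> 'g" where
  "right_add h = (SOME p. (\<exists>b. translation b p) \<and> p \<one> = h)"

lemma right_add:
  assumes "h \<in> carrier G"
  shows "\<exists>b. translation b (right_add h)" and "right_add h \<one> = h"
proof -
  have "\<exists>p. (\<exists>b. translation b p) \<and> p \<one> = h"
    using translation_exists[OF assms] by blast
  from someI_ex[OF this]
  show "\<exists>b. translation b (right_add h)" "right_add h \<one> = h"
    unfolding right_add_def[symmetric] by simp_all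
qed

lemma right_add_closed [simp, intro]:
  "\<lbrakk>g \<in> carrier G; h \<in> carrier G\<rbrakk> \<Longrightarrow> right_add h g \<in> carrier G"
  using right_add(1)[of h] translation_closed by blast

lemma right_add_eq:
  assumes "translation b p" "g \<in> carrier G"
  shows "p g = right_add (p \<one>) g"
proof -
  have c: "p \<one> \<in> carrier G"
    using assms by (auto simp: translation_def)
  obtain c where "translation c (right_add (p \<one>))"
    using right_add(1)[OF c] by blast
  then show ?thesis
    using translation_eqI[OF assms(1) _ G.one_closed _ assms(2)] right_add(2)[OF c] by simp
qed

text \<open>Associativity of the sum: the composite is again a translation, so it is fixed by its
  value at \<open>\<one>\<close>.\<close>

lemma right_add_right_add:
  assumes "g \<in> carrier G" "h \<in> carrier G" "k \<in> carrier G"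
  shows "right_add k (right_add h g) = right_add (right_add k h) g"
proof -
  obtain b c where "translation b (right_add k)" "translation c (right_add h)"
    using right_add(1) assms by blast
  from right_add_eq[OF translation_comp[OF this] assms(1)] show ?thesis
    using assms by (simp add: right_add(2))
qed

lemma right_add_left_inverse:
  assumes "g \<in> carrier G"
  shows "\<exists>k\<in>carrier G. right_add g k = \<one>"
proof -
  obtain b p q where p: "translation b p" "p \<one> = g" and q: "translation (\<ominus>\<^bsub>B\<^esub> b) q" "q g = \<one>"
    using translation_exists[OF assms] by blast
  have k: "q \<one> \<in> carrier G"
    using q by (auto simp: translation_def)
  \<comment> \<open>Fixing one point forces the translation \<open>p \<circ> q\<close> to be the
    identity; hence \<open>q \<one>\<close> is the left inverse sought.\<close>
  have "(p \<circ> q) g = g"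
    using p q by simp
  then have "(p \<circ> q) \<one> = \<one>"
    by (rule translation_eqI[OF translation_comp[OF p(1) q(1)] translation_id assms _ G.one_closed])
  then show ?thesis
    using k right_add_eq[OF p(1) k] p(2) by (intro bexI[of _ "q \<one>"]) simp_all
qed

text \<open>The translations are normalized by left multiplications, which is how skew
  distributivity enters: g(g^-1 h + k) = h + \<lambda>_g(k). It rests on \<open>mult_shift\<close>,
  the same law for shifts.\<close>

lemma translation_conj:
  assumes p: "translation b p" and g: "g \<in> carrier G"
  shows "translation (brace_lambda B (\<pi> g) b) (\<lambda>h. g \<otimes> p (inv g \<otimes> h))"
proof -
  have b: "b \<in> carrier B" and p_closed: "\<And>h. h \<in> carrier G \<Longrightarrow> p h \<in> carrier G"
    and \<pi>_p: "\<And>h. h \<in> carrier G \<Longrightarrow> \<pi> (p h) = \<pi> h \<oplus>\<^bsub>B\<^esub> b"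
    and p_shift: "\<And>h x. \<lbrakk>h \<in> carrier G; x \<in> carrier B\<rbrakk> \<Longrightarrow> p (shift x h) = shift (add_conj B b x) (p h)"
    using p by (auto simp: translation_def)
  have mult_shift: "k \<otimes> shift x h = shift (brace_lambda B (\<pi> k) x) (k \<otimes> h)"
    if "k \<in> carrier G" "h \<in> carrier G" "x \<in> carrier B" for k h x
    using that by (simp add: shift_def G.m_assoc B.inv_mult_group B.lam_mult)
  have "g \<otimes> p (inv g \<otimes> shift x h) = shift (add_conj B (brace_lambda B (\<pi> g) b) x) (g \<otimes> p (inv g \<otimes> h))"
    if "h \<in> carrier G" "x \<in> carrier B" for h x
    using that g b
    by (simp add: mult_shift p_shift p_closed add_conj_def B.lam_add B.lam_neg)
  moreover have "\<pi> (g \<otimes> p (inv g \<otimes> h)) = \<pi> h \<oplus>\<^bsub>B\<^esub> brace_lambda B (\<pi> g) b" if "h \<in> carrier G" for h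
    using that g b p_closed by (simp add: \<pi>_p B.mult_add flip: B.m_assoc)
  ultimately show ?thesis
    using g b p_closed by (auto simp: translation_def)
qed

section \<open>The skew brace on the covering group\<close>

definition cover_brace :: "'g ring" where
  "cover_brace = \<lparr>carrier = carrier G, mult = mult G, one = \<one>, zero = \<one>, add = \<lambda>g h. right_add h g\<rparr>"

lemma right_add_one: "g \<in> carrier G \<Longrightarrow> right_add \<one> g = g"
  using right_add_eq[OF translation_id, of g] by simp

lemma group_cover_add: "group (add_monoid cover_brace)"
  using right_add_left_inverse
  by (intro groupI) (auto simp: cover_brace_def right_add_right_add right_add(2) right_add_one)

text \<open>Skew distributivity, with \<open>n\<close> as the negative of \<open>g\<close>. As
  functions of \<open>g \<otimes> h\<close> both sides are translations, and at the point
  \<open>g\<close> both take the value \<open>g \<otimes> k\<close>.\<close>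

lemma right_add_mult:
  assumes "g \<in> carrier G" "h \<in> carrier G" "k \<in> carrier G" "n \<in> carrier G"
    and n: "right_add n g = \<one>"
  shows "g \<otimes> right_add k h = right_add (g \<otimes> k) (right_add n (g \<otimes> h))"
proof -
  obtain b c d where t: "translation b (right_add k)" "translation c (right_add (g \<otimes> k))"
    "translation d (right_add n)"
    using right_add(1)[OF assms(3)] right_add(1)[OF G.m_closed[OF assms(1,3)]]
      right_add(1)[OF assms(4)] by (elim exE) (rule that)
  have "g \<otimes> right_add k (inv g \<otimes> g) = (right_add (g \<otimes> k) \<circ> right_add n) g"
    using assms by (simp add: right_add(2))
  from translation_eqI[OF translation_conj[OF t(1) assms(1)] translation_comp[OF t(2,3)] assms(1) this]
  have "g \<otimes> right_add k (inv g \<otimes> (g \<otimes> h)) = (right_add (g \<otimes> k) \<circ> right_add n) (g \<otimes> h)"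
    using assms by simp
  then show ?thesis
    using assms by (simp flip: G.m_assoc)
qed

lemma cover_neg:
  assumes "g \<in> carrier G"
  shows "\<ominus>\<^bsub>cover_brace\<^esub> g \<in> carrier G" "right_add (\<ominus>\<^bsub>cover_brace\<^esub> g) g = \<one>"
  using group.inv_closed[OF group_cover_add, of g] group.r_inv[OF group_cover_add, of g] assms
  by (simp_all add: a_inv_def) (simp_all add: cover_brace_def)

lemma skew_brace_cover: "skew_brace cover_brace"
proof (rule skew_brace.intro[OF group_cover_add])
  show "group cover_brace"
    using G.group_axioms unfolding group_def group_axioms_def monoid_def Units_def
    by (simp add: cover_brace_def)
  fix a b c
  assume "a \<in> carrier cover_brace" "b \<in> carrier cover_brace" "c \<in> carrier cover_brace"
  then have "a \<in> carrier G" "b \<in> carrier G" "c \<in> carrier G"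
    by (simp_all add: cover_brace_def)
  then show "a \<otimes>\<^bsub>cover_brace\<^esub> (b \<oplus>\<^bsub>cover_brace\<^esub> c) =
      a \<otimes>\<^bsub>cover_brace\<^esub> b \<oplus>\<^bsub>cover_brace\<^esub> \<ominus>\<^bsub>cover_brace\<^esub> a \<oplus>\<^bsub>cover_brace\<^esub> a \<otimes>\<^bsub>cover_brace\<^esub> c"
    using right_add_mult[of a b c "\<ominus>\<^bsub>cover_brace\<^esub> a"] cover_neg[of a]
    by (simp add: cover_brace_def)
qed

lemma lam_cover:
  assumes "x \<in> carrier B" "y \<in> carrier B"
  shows "brace_lambda cover_brace (j x) (j y) = j (brace_lambda B x y)"
proof (rule skew_brace.lam_eqI[OF skew_brace_cover])
  have "right_add (j z) g = shift z g" if "z \<in> carrier B" "g \<in> carrier G" for z g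
    using right_add_eq[OF translation_shift[OF that(1)] that(2)] that by (simp add: shift_def)
  then show "j x \<otimes>\<^bsub>cover_brace\<^esub> j y = j x \<oplus>\<^bsub>cover_brace\<^esub> j (brace_lambda B x y)"
    using assms by (simp add: cover_brace_def) (simp add: shift_def)
qed (use assms in \<open>auto simp: cover_brace_def\<close>)

end
section \<open>Presented groups\<close>

lemma Nil_words [simp]: "[] \<in> words X"
  by (simp add: words_def)

lemma append_words [simp]: "u @ v \<in> words X \<longleftrightarrow> u \<in> words X \<and> v \<in> words X"
  by (simp add: words_def)

lemma word_eq_words: "(u, v) \<in> word_eq X R \<Longrightarrow> u \<in> words X \<and> v \<in> words X"
  by (induction rule: word_eq.induct) (auto simp: words_def)

lemma equiv_word_eq: "equiv (words X) (word_eq X R)"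
proof (rule equivI)
  show "word_eq X R \<subseteq> words X \<times> words X"
    using word_eq_words[of _ _ X R] by auto
  show "refl_on (words X) (word_eq X R)"
    by (auto intro!: refl_onI word_eq.refl)
  show "sym (word_eq X R)"
    by (auto intro!: symI word_eq.sym)
  show "trans (word_eq X R)"
    by (auto intro!: transI elim: word_eq.trans)
qed

definition word_class :: "'a set \<Rightarrow> ('a word \<times> 'a word) set \<Rightarrow> 'a word \<Rightarrow> 'a word set" where
  "word_class X R u = word_eq X R `` {u}"

lemma word_class_eqI: "(u, v) \<in> word_eq X R \<Longrightarrow> word_class X R u = word_class X R v"
  unfolding word_class_def by (rule equiv_class_eq[OF equiv_word_eq])

lemma carrier_presented_group: "carrier (presented_group X R) = word_class X R ` words X"
  by (auto simp: presented_group_def quotient_def word_class_def)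

lemma one_presented_group: "\<one>\<^bsub>presented_group X R\<^esub> = word_class X R []"
  by (simp add: presented_group_def word_class_def)

lemma mult_presented_group:
  assumes "u \<in> words X" "v \<in> words X"
  shows "word_class X R u \<otimes>\<^bsub>presented_group X R\<^esub> word_class X R v = word_class X R (u @ v)"
proof -
  have "word_class X R (u' @ v') = word_class X R (u @ v)"
    if "u' \<in> word_class X R u" "v' \<in> word_class X R v" for u' v'
    using that by (intro word_class_eqI) (auto simp: word_class_def intro: word_eq.intros)
  moreover have "word_class X R u \<noteq> {}" "word_class X R v \<noteq> {}"
    using assms by (auto simp: word_class_def intro: word_eq.refl)
  ultimately have "(\<Union>u'\<in>word_class X R u. \<Union>v'\<in>word_class X R v. word_class X R (u' @ v'))
      = word_class X R (u @ v)"
    by (intro SUP_eq_const)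
  then show ?thesis
    by (simp add: presented_group_def word_class_def)
qed

definition inverse_word :: "'a word \<Rightarrow> 'a word" where
  "inverse_word u = rev (map (\<lambda>(x, b). (x, \<not> b)) u)"

lemma inverse_word_words: "u \<in> words X \<Longrightarrow> inverse_word u \<in> words X"
  by (auto simp: words_def inverse_word_def in_lists_conv_set)

lemma inverse_word_cancel:
  assumes "u \<in> words X"
  shows "(inverse_word u @ u, []) \<in> word_eq X R"
  using assms
proof (induction u)
  case Nil
  then show ?case
    by (auto simp: inverse_word_def words_def intro: word_eq.refl)
next
  case (Cons a u)
  obtain x b where a: "a = (x, b)"
    by (cases a)
  have x: "x \<in> X" and u: "u \<in> words X"
    using Cons.prems by (auto simp: words_def a)
  have "([(x, \<not> b), (x, b)], []) \<in> word_eq X R"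
    using word_eq.cancel[OF x, of "\<not> b"] by simp
  then have "(inverse_word u @ [(x, \<not> b), (x, b)] @ u, inverse_word u @ [] @ u) \<in> word_eq X R"
    using u by (intro word_eq.append word_eq.refl inverse_word_words)
  then show ?case
    using word_eq.trans[OF _ Cons.IH[OF u]] by (simp add: a inverse_word_def)
qed

lemma group_presented_group: "group (presented_group X R)"
proof (rule groupI)
  fix A
  assume "A \<in> carrier (presented_group X R)"
  then obtain u where u: "u \<in> words X" "A = word_class X R u"
    by (auto simp: carrier_presented_group)
  show "\<one>\<^bsub>presented_group X R\<^esub> \<otimes>\<^bsub>presented_group X R\<^esub> A = A"
    using u by (simp add: one_presented_group mult_presented_group)
  show "\<exists>B\<in>carrier (presented_group X R). B \<otimes>\<^bsub>presented_group X R\<^esub> A = \<one>\<^bsub>presented_group X R\<^esub>"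
    using u inverse_word_words[OF u(1)] word_class_eqI[OF inverse_word_cancel[OF u(1)]]
    by (intro bexI[of _ "word_class X R (inverse_word u)"])
      (auto simp: one_presented_group mult_presented_group carrier_presented_group)
qed (auto simp: carrier_presented_group one_presented_group mult_presented_group)

section \<open>Evaluation of words and the universal property\<close>

definition eval_word :: "('g, 'm) monoid_scheme \<Rightarrow> ('a \<Rightarrow> 'g) \<Rightarrow> 'a word \<Rightarrow> 'g" where
  "eval_word G f u = foldr (\<lambda>(x, b) g. (if b then f x else inv\<^bsub>G\<^esub> (f x)) \<otimes>\<^bsub>G\<^esub> g) u \<one>\<^bsub>G\<^esub>"

context group
begin

lemma eval_word_closed:
  assumes "f ` X \<subseteq> carrier G" "u \<in> words X"
  shows "eval_word G f u \<in> carrier G"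
  using assms(2)
proof (induction u)
  case (Cons a u)
  then show ?case
    using assms(1) by (cases a) (auto simp: eval_word_def words_def image_subset_iff)
qed (simp add: eval_word_def)

lemma eval_word_append:
  assumes f: "f ` X \<subseteq> carrier G" and v: "v \<in> words X" and "u \<in> words X"
  shows "eval_word G f (u @ v) = eval_word G f u \<otimes> eval_word G f v"
  using assms(3)
proof (induction u)
  case Nil
  then show ?case
    using eval_word_closed[OF f v] by (simp add: eval_word_def)
next
  case (Cons a u)
  obtain x b where a: "a = (x, b)"
    by (cases a)
  have "x \<in> X" and u: "u \<in> words X"
    using Cons.prems by (auto simp: words_def a)
  then have "f x \<in> carrier G"
    using f by auto
  then show ?case
    using Cons.IH[OF u] eval_word_closed[OF f v] eval_word_closed[OF f u]
    by (simp add: eval_word_def a m_assoc)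
qed

lemma eval_word_eq:
  assumes f: "f ` X \<subseteq> carrier G"
    and R: "\<And>u v. (u, v) \<in> R \<Longrightarrow> eval_word G f u = eval_word G f v"
    and "(u, v) \<in> word_eq X R"
  shows "eval_word G f u = eval_word G f v"
  using assms(3)
proof (induction rule: word_eq.induct)
  case (cancel x b)
  then have "f x \<in> carrier G"
    using f by auto
  then show ?case
    by (simp add: eval_word_def)
next
  case (append u v u' v')
  then show ?case
    using eval_word_append[OF f] word_eq_words by metis
qed (use R in auto)

lemma presented_group_hom:
  assumes f: "f ` X \<subseteq> carrier G"
    and R: "\<And>u v. (u, v) \<in> R \<Longrightarrow> eval_word G f u = eval_word G f v"
  obtains h where "h \<in> hom (presented_group X R) G"
    "\<And>x. x \<in> X \<Longrightarrow> h (word_class X R [(x, True)]) = f x"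
proof
  \<comment> \<open>Evaluation is constant on each class of words, so its image of a class is a
    singleton.\<close>
  let ?h = "\<lambda>A. the_elem (eval_word G f ` A)"
  have h: "?h (word_class X R u) = eval_word G f u" if "u \<in> words X" for u
  proof (rule the_elem_image_unique)
    show "word_class X R u \<noteq> {}"
      using that by (auto simp: word_class_def intro: word_eq.refl)
    show "eval_word G f v = eval_word G f u" if "v \<in> word_class X R u" for v
      using that eval_word_eq[where R = R and u = u and v = v, OF f R] by (simp add: word_class_def)
  qed
  show "?h \<in> hom (presented_group X R) G"
    by (auto simp: hom_def carrier_presented_group h mult_presented_group
        eval_word_closed[OF f] eval_word_append[OF f])
  show "?h (word_class X R [(x, True)]) = f x" if "x \<in> X" for x
  proof -
    have "f x \<in> carrier G" "[(x, True)] \<in> words X"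
      using that f by (auto simp: words_def)
    then show ?thesis
      by (simp add: h) (simp add: eval_word_def)
  qed
qed

end

lemma generate_presented_group:
  "generate (presented_group X R) ((\<lambda>x. word_class X R [(x, True)]) ` X) = carrier (presented_group X R)"
    (is "generate ?G ?S = _")
proof
  interpret group ?G
    by (rule group_presented_group)
  have letter: "[(x, b)] \<in> words X" if "x \<in> X" for x b
    using that by (simp add: words_def)
  show "generate ?G ?S \<subseteq> carrier ?G"
    by (rule generate_incl) (auto simp: carrier_presented_group letter)
  have "word_class X R u \<in> generate ?G ?S" if "u \<in> words X" for u
    using that
  proof (induction u)
    case Nil
    show ?case
      using generate.one[of ?G ?S] by (simp add: one_presented_group)
  next
    case (Cons a u)
    obtain x b where a: "a = (x, b)"
      by (cases a)
    have x: "x \<in> X" and u: "u \<in> words X"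
      using Cons.prems by (auto simp: words_def a)
    have "inv\<^bsub>?G\<^esub> (word_class X R [(x, True)]) = word_class X R [(x, False)]"
      using x word_class_eqI[OF word_eq.cancel[OF x, of False R]]
      by (intro inv_equality)
        (auto simp: letter mult_presented_group one_presented_group carrier_presented_group)
    then have "word_class X R [(x, b)] \<in> generate ?G ?S"
      using x generate.incl[of "word_class X R [(x, True)]" ?S ?G]
        generate.inv[of "word_class X R [(x, True)]" ?S ?G]
      by (cases b) auto
    from generate.eng[OF this Cons.IH[OF u]] show ?case
      using x u by (simp add: mult_presented_group letter a)
  qed
  then show "carrier ?G \<subseteq> generate ?G ?S"
    by (auto simp: carrier_presented_group)
qed

text \<open>Transfers generation from the structure group to its skew brace, a record of another
  type with the same multiplicative part.\<close>

lemma generate_cong: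
  assumes "carrier G = carrier H" "mult G = mult H" "\<one>\<^bsub>G\<^esub> = \<one>\<^bsub>H\<^esub>"
  shows "generate G S = generate H S"
proof -
  have inv: "m_inv G = m_inv H"
    using assms by (simp add: m_inv_def fun_eq_iff)
  have "x \<in> generate H S" if "x \<in> generate G S" for x
    using that by (induction rule: generate.induct) (auto simp: assms inv intro: generate.intros)
  moreover have "x \<in> generate G S" if "x \<in> generate H S" for x
    using that
    by (induction rule: generate.induct)
      (auto simp flip: assms(2,3) inv intro: generate.intros)
  ultimately show ?thesis
    by blast
qed

section \<open>The structure skew brace\<close>

lemma structure_map_eq:
  "structure_map X r x = word_class X (structure_relations X r) [(x, True)]"
  by (simp add: structure_map_def word_class_def)

lemma structure_map_closed: "x \<in> X \<Longrightarrow> structure_map X r x \<in> carrier (structure_group X r)"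
  by (simp add: structure_map_eq structure_group_def carrier_presented_group words_def)

lemma group_structure_group: "group (structure_group X r)"
  by (simp add: structure_group_def group_presented_group)

lemma structure_map_relation:
  assumes r: "r \<in> X \<times> X \<rightarrow> X \<times> X" and xy: "x \<in> X" "y \<in> X"
  shows "structure_map X r x \<otimes>\<^bsub>structure_group X r\<^esub> structure_map X r y =
    structure_map X r (fst (r (x, y))) \<otimes>\<^bsub>structure_group X r\<^esub> structure_map X r (snd (r (x, y)))"
proof -
  have "r (x, y) \<in> X \<times> X"
    using r xy by auto
  then have "[(fst (r (x, y)), True)] \<in> words X" "[(snd (r (x, y)), True)] \<in> words X"
    "[(fst (r (x, y)), True), (snd (r (x, y)), True)] \<in> words X"
    by (auto simp: words_def)
  moreover have "[(x, True)] \<in> words X" "[(y, True)] \<in> words X" "[(x, True), (y, True)] \<in> words X"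
    using xy by (auto simp: words_def)
  moreover have "([(x, True), (y, True)], [(fst (r (x, y)), True), (snd (r (x, y)), True)])
      \<in> structure_relations X r"
    using xy by (auto simp: structure_relations_def)
  ultimately show ?thesis
    by (simp add: structure_group_def structure_map_eq mult_presented_group word_class_eqI word_eq.rel)
qed

lemma sol_hom_factor:
  assumes r: "r \<in> X \<times> X \<rightarrow> X \<times> X"
    and f: "sol_epi X r Y s f" and g: "sol_hom X r Z w g"
    and ker: "\<And>x y. \<lbrakk>x \<in> X; y \<in> X; f x = f y\<rbrakk> \<Longrightarrow> g x = g y"
  obtains q where "sol_hom Y s Z w q" "\<And>x. x \<in> X \<Longrightarrow> q (f x) = g x"
proof
  \<comment> \<open>Any preimage serves, because \<open>g\<close> is constant on the fibres of
    \<open>f\<close>.\<close>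
  let ?q = "\<lambda>y. g (inv_into X f y)"
  show q: "?q (f x) = g x" if "x \<in> X" for x
    using that by (intro ker) (auto simp: inv_into_into f_inv_into_f)
  have Y: "f ` X = Y" and f_hom: "\<And>x y. \<lbrakk>x \<in> X; y \<in> X\<rbrakk> \<Longrightarrow> s (f x, f y) = map_prod f f (r (x, y))"
    using f by (auto simp: sol_epi_def sol_hom_def)
  have g_in: "g \<in> X \<rightarrow> Z" and g_hom: "\<And>x y. \<lbrakk>x \<in> X; y \<in> X\<rbrakk> \<Longrightarrow> w (g x, g y) = map_prod g g (r (x, y))"
    using g by (auto simp: sol_hom_def)
  have "map_prod ?q ?q (s (f x, f y)) = w (?q (f x), ?q (f y))" if "x \<in> X" "y \<in> X" for x y
  proof -
    have "r (x, y) \<in> X \<times> X"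
      using r that by auto
    then show ?thesis
      using that by (cases "r (x, y)") (simp add: q f_hom g_hom)
  qed
  moreover have "?q (f x) \<in> Z" if "x \<in> X" for x
    using that g_in by (simp add: q Pi_iff)
  ultimately show "sol_hom Y s Z w ?q"
    unfolding sol_hom_def Y[symmetric] by blast
qed

lemma (in skew_brace_hom) hom_solution:
  assumes "a \<in> carrier B" "b \<in> carrier B"
  shows "brace_solution C (h a, h b) = map_prod h h (brace_solution B (a, b))"
  using assms by (simp add: brace_solution_def brace_rho_def hom_lam)

text \<open>The universal property extends \<open>f\<close> to \<open>\<pi>\<close> on the structure
  group, and the kernel condition lets the canonical map descend to \<open>j\<close> on
  \<open>B\<close>. These are the data of \<open>brace_cover\<close>, whose sum is the required
  addition.\<close>

theorem structure_addition_exists: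
  assumes r: "r \<in> X \<times> X \<rightarrow> X \<times> X" and B: "skew_brace B"
    and f: "sol_epi X r (carrier B) (brace_solution B) f"
    and ker: "\<And>x y. \<lbrakk>x \<in> X; y \<in> X; f x = f y\<rbrakk> \<Longrightarrow> structure_map X r x = structure_map X r y"
  shows "\<exists>pl. structure_addition X r pl"
proof -
  interpret B: skew_brace B by fact
  let ?G = "structure_group X r" and ?\<iota> = "structure_map X r"
  interpret G: group ?G
    by (rule group_structure_group)
  have f_img: "f ` X = carrier B" and f_hom: "\<And>x y. \<lbrakk>x \<in> X; y \<in> X\<rbrakk> \<Longrightarrow>
      brace_lambda B (f x) (f y) = f (fst (r (x, y))) \<and> brace_rho B (f y) (f x) = f (snd (r (x, y)))"
    using f by (auto simp: sol_epi_def sol_hom_def brace_solution_def prod_eq_iff)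
  have f_closed: "f x \<in> carrier B" if "x \<in> X" for x
    using that f_img by blast
  have r_closed: "fst (r (x, y)) \<in> X" "snd (r (x, y)) \<in> X" if "x \<in> X" "y \<in> X" for x y
    using r that by (metis PiE SigmaI mem_Times_iff)+
  have "eval_word B f u = eval_word B f v" if uv: "(u, v) \<in> structure_relations X r" for u v
  proof -
    obtain x y where xy: "x \<in> X" "y \<in> X" and u: "u = [(x, True), (y, True)]"
      and v: "v = [(fst (r (x, y)), True), (snd (r (x, y)), True)]"
      using uv by (auto simp: structure_relations_def)
    have "f x \<otimes>\<^bsub>B\<^esub> f y = f (fst (r (x, y))) \<otimes>\<^bsub>B\<^esub> f (snd (r (x, y)))"
      using B.lam_mult_rho[OF f_closed[OF xy(1)] f_closed[OF xy(2)]] f_hom[OF xy] by simp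
    then show ?thesis
      using f_closed xy r_closed by (simp add: eval_word_def u v)
  qed
  then obtain \<pi> where \<pi>: "\<pi> \<in> hom ?G B" "\<And>x. x \<in> X \<Longrightarrow> \<pi> (?\<iota> x) = f x"
    using B.presented_group_hom[of f X "structure_relations X r"] f_img
    unfolding structure_group_def structure_map_eq by blast
  let ?j = "\<lambda>b. ?\<iota> (inv_into X f b)"
  have j: "?j (f x) = ?\<iota> x" if "x \<in> X" for x
    using that by (intro ker) (auto simp: inv_into_into f_inv_into_f)
  have j_img: "?j ` carrier B = ?\<iota> ` X"
    using j by (auto simp: image_iff simp flip: f_img)
  have f_surj: "\<exists>x\<in>X. b = f x" if "b \<in> carrier B" for b
    using that f_img by blast
  interpret brace_cover B ?G \<pi> ?j
  proof
    show "\<pi> \<in> hom ?G B" by fact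
    fix x assume x: "x \<in> carrier B"
    then show "?j x \<in> carrier ?G" "\<pi> (?j x) = x"
      using f_surj j \<pi>(2) structure_map_closed by metis+
    fix y assume y: "y \<in> carrier B"
    obtain a b where ab: "a \<in> X" "b \<in> X" "x = f a" "y = f b"
      using f_surj x y by blast
    show "?j x \<otimes>\<^bsub>?G\<^esub> ?j y = ?j (brace_lambda B x y) \<otimes>\<^bsub>?G\<^esub> ?j (brace_rho B y x)"
      unfolding ab using ab(1,2) structure_map_relation[OF r ab(1,2)]
      by (simp add: f_hom j r_closed)
  next
    show "generate ?G (?j ` carrier B) = carrier ?G"
      unfolding j_img using generate_presented_group[of X "structure_relations X r"]
      by (simp add: structure_group_def structure_map_eq)
  qed
  have brace: "structure_group_with_add X r (\<lambda>g h. right_add h g) = cover_brace"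
    by (simp add: structure_group_with_add_def cover_brace_def)
  have "brace_solution cover_brace (?\<iota> x, ?\<iota> y) = map_prod ?\<iota> ?\<iota> (r (x, y))" if xy: "x \<in> X" "y \<in> X" for x y
  proof -
    interpret D: skew_brace cover_brace
      by (rule skew_brace_cover)
    have c: "?\<iota> z \<in> carrier cover_brace" if "z \<in> X" for z
      using structure_map_closed[OF that] by (simp add: cover_brace_def)
    have lam: "brace_lambda cover_brace (?\<iota> x) (?\<iota> y) = ?\<iota> (fst (r (x, y)))"
      using lam_cover[of "f x" "f y"] xy f_closed by (simp add: j f_hom r_closed)
    \<comment> \<open>With the first component of the solution known, the defining relation of the
      group determines the second by cancellation.\<close>
    have "?\<iota> x \<otimes>\<^bsub>cover_brace\<^esub> ?\<iota> y = ?\<iota> (fst (r (x, y))) \<otimes>\<^bsub>cover_brace\<^esub> ?\<iota> (snd (r (x, y)))"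
      using structure_map_relation[OF r xy] by (simp add: cover_brace_def)
    then have "brace_rho cover_brace (?\<iota> y) (?\<iota> x) = ?\<iota> (snd (r (x, y)))"
      unfolding brace_rho_def lam using xy c r_closed
      by (simp add: D.m_assoc) (simp flip: D.m_assoc)
    then show ?thesis
      by (simp add: brace_solution_def lam prod_eq_iff)
  qed
  then have "structure_addition X r (\<lambda>g h. right_add h g)"
    unfolding structure_addition_def brace using skew_brace_cover by blast
  then show ?thesis
    by (rule exI[of "structure_addition X r"])
qed

text \<open>The coset condition \<open>ker\<close> makes \<open>g\<close> modulo \<open>J\<close>
  constant on the fibres of \<open>f\<close>, so it descends to a solution homomorphism from
  \<open>C\<close> onto the quotient. Solubility passes to the quotient, and then to
  \<open>D\<close> because \<open>J\<close> is abelian.\<close>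

lemma soluble_step:
  assumes r: "r \<in> X \<times> X \<rightarrow> X \<times> X" and C: "skew_brace C" and D: "skew_brace D"
    and f: "sol_epi X r (carrier C) (brace_solution C) f"
    and g: "sol_epi X r (carrier D) (brace_solution D) g"
    and J: "abelian_brace_ideal J D"
    and ker: "\<And>x y. (x, y) \<in> ker_rel X f \<Longrightarrow> g x <#\<^bsub>D\<^esub> J = g y <#\<^bsub>D\<^esub> J"
    and sol: "soluble_ideal C (carrier C)"
  shows "soluble_ideal D (carrier D)"
proof -
  interpret D: skew_brace D by fact
  interpret J: ideal_of_brace J D
    using J by unfold_locales (simp add: abelian_brace_ideal_def)
  let ?p = "\<lambda>d. J #>\<^bsub>D\<^esub> d" and ?Q = "brace_quotient D J"
  have g_img: "g ` X = carrier D" and g_hom: "\<And>x y. \<lbrakk>x \<in> X; y \<in> X\<rbrakk> \<Longrightarrow>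
      map_prod g g (r (x, y)) = brace_solution D (g x, g y)"
    using g by (auto simp: sol_epi_def sol_hom_def)
  have g_closed: "g x \<in> carrier D" if "x \<in> X" for x
    using that g_img by blast
  have pg: "sol_hom X r (carrier ?Q) (brace_solution ?Q) (\<lambda>x. ?p (g x))"
    unfolding sol_hom_def
  proof (intro conjI ballI)
    fix x y assume xy: "x \<in> X" "y \<in> X"
    have "map_prod (\<lambda>x. ?p (g x)) (\<lambda>x. ?p (g x)) (r (x, y)) = map_prod ?p ?p (map_prod g g (r (x, y)))"
      by (simp add: prod.map_comp comp_def)
    then show "map_prod (\<lambda>x. ?p (g x)) (\<lambda>x. ?p (g x)) (r (x, y)) = brace_solution ?Q (?p (g x), ?p (g y))"
      using xy g_closed by (simp only: g_hom J.proj.hom_solution)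
  qed (use g_closed in \<open>auto simp: J.carrier_quotient\<close>)
  have "?p (g x) = ?p (g y)" if "x \<in> X" "y \<in> X" "f x = f y" for x y
    using ker[of x y] that g_closed by (simp add: ker_rel_def J.mult.coset_eq)
  then obtain q where q: "sol_hom (carrier C) (brace_solution C) (carrier ?Q) (brace_solution ?Q) q"
    and q_eq: "\<And>x. x \<in> X \<Longrightarrow> q (f x) = ?p (g x)"
    using sol_hom_factor[OF r f pg] by blast
  have "q ` carrier C = q ` f ` X"
    using f by (simp add: sol_epi_def)
  also have "\<dots> = ?p ` g ` X"
    using q_eq by (simp add: image_image)
  finally have q_img: "q ` carrier C = carrier ?Q"
    unfolding g_img J.carrier_quotient .
  interpret q: brace_solution_hom C ?Q q
  proof (intro brace_solution_hom.intro brace_solution_hom_axioms.intro C J.skew_brace_quotient q)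
    show "generate ?Q (q ` carrier C) = carrier ?Q"
      unfolding q_img
      using group.generate_incl[OF J.group_quotient subset_refl] generate.incl[of _ "carrier ?Q" ?Q]
      by (intro subset_antisym subsetI) auto
  qed
  show ?thesis
  proof (rule J.proj.soluble_extension)
    show "soluble_ideal ?Q (carrier ?Q)"
      by (rule q.soluble_target[OF sol])
    have "a \<oplus>\<^bsub>D\<^esub> b = a \<otimes>\<^bsub>D\<^esub> b \<and> a \<otimes>\<^bsub>D\<^esub> b = b \<otimes>\<^bsub>D\<^esub> a" if "a \<in> J" "b \<in> J" for a b
      using J that comm_monoid.m_comm[of "D\<lparr>carrier := J\<rparr>" a b]
      by (simp add: abelian_brace_ideal_def abelian_skew_brace_def comm_group_def)
    then have "abelian_mod D J {\<zero>\<^bsub>D\<^esub>}"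
      unfolding abelian_mod_def using J.mult.subset by (auto simp: subset_iff)
    then show "abelian_mod D {d \<in> carrier D. ?p d = \<zero>\<^bsub>?Q\<^esub>} {\<zero>\<^bsub>D\<^esub>}"
      unfolding J.kernel_proj .
  qed
qed

lemma soluble_structure_skew_brace:
  assumes r: "r \<in> X \<times> X \<rightarrow> X \<times> X" and B: "skew_brace B"
    and f: "sol_epi X r (carrier B) (brace_solution B) f"
    and ker: "\<And>x y. \<lbrakk>x \<in> X; y \<in> X; f x = f y\<rbrakk> \<Longrightarrow> structure_map X r x = structure_map X r y"
    and sol: "soluble_ideal B (carrier B)"
  shows "soluble_skew_brace (structure_skew_brace X r)"
proof -
  let ?D = "structure_skew_brace X r" and ?\<iota> = "structure_map X r"
  have add: "structure_addition X r (SOME pl. structure_addition X r pl)"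
    by (rule someI_ex[OF structure_addition_exists[OF r B f ker]])
  then interpret D: skew_brace ?D
    unfolding structure_skew_brace_def structure_addition_def by blast
  have carrier: "carrier ?D = carrier (structure_group X r)" and mult: "mult ?D = mult (structure_group X r)"
    and one: "\<one>\<^bsub>?D\<^esub> = \<one>\<^bsub>structure_group X r\<^esub>"
    by (simp_all add: structure_skew_brace_def structure_group_with_add_def)
  have \<iota>: "sol_hom X r (carrier ?D) (brace_solution ?D) ?\<iota>"
    using add structure_map_closed[of _ X r] unfolding sol_hom_def carrier
    by (simp add: structure_addition_def structure_skew_brace_def)
  obtain q where q: "sol_hom (carrier B) (brace_solution B) (carrier ?D) (brace_solution ?D) q"
    and q_eq: "\<And>x. x \<in> X \<Longrightarrow> q (f x) = ?\<iota> x"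
    by (rule sol_hom_factor[OF r f \<iota>]) (erule (2) ker, rule that)
  have "q ` carrier B = q ` f ` X"
    using f by (simp add: sol_epi_def)
  also have "\<dots> = ?\<iota> ` X"
    using q_eq by (simp add: image_image)
  finally have q_img: "q ` carrier B = ?\<iota> ` X" .
  interpret q: brace_solution_hom B ?D q
  proof (intro brace_solution_hom.intro brace_solution_hom_axioms.intro B D.skew_brace_axioms q)
    show "generate ?D (q ` carrier B) = carrier ?D"
      unfolding q_img carrier generate_cong[OF carrier mult one]
      using generate_presented_group[of X "structure_relations X r"]
      by (simp add: structure_group_def structure_map_eq)
  qed
  show ?thesis
    by (rule D.soluble_skew_braceI[OF q.soluble_target[OF sol]])
qed

theorem theorem4p2:
  fixes X :: "'a set" and r :: "'a \<times> 'a \<Rightarrow> 'a \<times> 'a"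
  assumes "soluble_solution TYPE('b) X r"
  shows "soluble_skew_brace (structure_skew_brace X r)"
proof -
  have r: "r \<in> X \<times> X \<rightarrow> X \<times> X"
    using assms by (simp add: soluble_solution_def yb_solution_def)
  obtain t :: nat and B :: "nat \<Rightarrow> 'b ring" and f K
    where B: "\<forall>k\<le>t. skew_brace (B k)"
      and f: "\<forall>k\<le>t. sol_epi X r (carrier (B k)) (brace_solution (B k)) (f k)"
      and f0: "X // ker_rel X (f 0) = {X}"
      and ft: "ker_rel X (f t) \<subseteq> ker_rel X (structure_map X r)"
      and step: "\<forall>k\<in>{1..t}. ker_rel X (f k) \<subseteq> ker_rel X (f (k - 1)) \<and>
        (\<exists>J. abelian_brace_ideal J (B k) \<and> f k ` K (k - 1) \<subseteq> J \<and>
          (\<forall>(x, y) \<in> ker_rel X (f (k - 1)). f k x <#\<^bsub>B k\<^esub> J = f k y <#\<^bsub>B k\<^esub> J))"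
    using assms unfolding soluble_solution_def by (elim conjE exE) (rule that)
  have "soluble_ideal (B k) (carrier (B k))" if "k \<le> t" for k
    using that
  proof (induction k)
    case 0
    interpret skew_brace "B 0"
      using B by simp
    have img: "f 0 ` X = carrier (B 0)"
      using f by (simp add: sol_epi_def)
    \<comment> \<open>With a single class \<open>f 0\<close> is constant; being onto, it makes
      \<open>B 0\<close> the trivial skew brace.\<close>
    have "X \<in> X // ker_rel X (f 0)"
      using f0 by simp
    then obtain x where x: "X = ker_rel X (f 0) `` {x}"
      by (rule quotientE)
    have "f 0 y = f 0 x" if "y \<in> X" for y
      using subsetD[OF equalityD1[OF x] that] by (simp add: ker_rel_def)
    then have "b = f 0 x" if "b \<in> carrier (B 0)" for b
      using that img by (metis imageE)
    then have "carrier (B 0) = {\<zero>\<^bsub>B 0\<^esub>}"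
      using add.one_closed by (metis (no_types, lifting) singletonI singletonD subsetI subset_antisym)
    then show ?case
      using soluble_ideal.zero[of "B 0"] by simp
  next
    case (Suc k)
    obtain J where J: "abelian_brace_ideal J (B (Suc k))"
      and ker: "\<forall>(x, y) \<in> ker_rel X (f k). f (Suc k) x <#\<^bsub>B (Suc k)\<^esub> J = f (Suc k) y <#\<^bsub>B (Suc k)\<^esub> J"
      using bspec[OF step, of "Suc k"] Suc.prems by auto
    show ?case
      using Suc.prems ker
      by (intro soluble_step[OF r B[rule_format] B[rule_format] f[rule_format] f[rule_format] J _ Suc.IH])
        auto
  qed
  then show ?thesis
    using ft f B
    by (intro soluble_structure_skew_brace[OF r, of "B t" "f t"]) (auto simp: ker_rel_def)
qed

end
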